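(* Let $p$ be a prime, let $m \ge 2$ be an integer, and let $\delta>0$, $\nu>0$, $\epsilon>0$. Then there exists $C_{\mathrm{cor}}(\delta,\nu,\epsilon,p,m)>0$ such that the following holds. If $s$ is a positive integer and $\mathcal{A}_1,\dots,\mathcal{A}_s$ are non-empty subsets of $\{0,1\}^n$ each with density at least $\delta$ inside $\{0,1\}^n$, then there exists a subset $R \subset [s]$ with $|R| \ge s/(n+1)^{C_{\mathrm{cor}}(\delta,\nu,\epsilon,p,m)}$ such that for at least $(1-\epsilon)|R|^m$ of the $m$-tuples $(i_1,\dots,i_m) \in R^m$ we have \[\mathrm{cor}_{\mathcal{A}_{i_1},\dots,\mathcal{A}_{i_m}}\phi \ge -\nu\] for every mod-$p$ form $\phi$.
   Context: A mod-$p$ form is a linear form $\phi:\mathbb{F}_p^n\to\mathbb{F}_p$, $\phi(x)=a_1x_1+\dots+a_nx_n$; it is evaluated on $\{0,1\}^n$ by identifying $\{0,1\}$ with the elements $0,1$ of $\mathbb{F}_p$. The density of $\mathcal{A}\subset\{0,1\}^n$ is $|\mathcal{A}|/2^n$. For random variables $X_1,\dots,X_m$ taking values in a finite set $D$, the correlation is $\mathrm{cor}(X_1,\dots,X_m)=\big(\sum_{d\in D}\mathbb{P}[X_1=d]\cdots\mathbb{P}[X_m=d]\big)-1/|D|^{m-1}$. For a function $F$ on $\{0,1\}^n$ and non-empty $\mathcal{A}_1,\dots,\mathcal{A}_m\subset\{0,1\}^n$, $\mathrm{cor}_{\mathcal{A}_1,\dots,\mathcal{A}_m}(F)$ denotes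 $\mathrm{cor}(X_1,\dots,X_m)$ where $X_i$ is distributed as $F(x)$ for $x$ uniform in $\mathcal{A}_i$ (for a mod-$p$ form, $D=\mathbb{F}_p$). *)

theory Defs
  imports "HOL-Probability.Probability" "HOL-Number_Theory.Residues"
begin

abbreviation F_ring :: "nat \<Rightarrow> int ring" where
  "F_ring p \<equiv> residue_ring (int p)"

definition F_space :: "nat \<Rightarrow> nat \<Rightarrow> (nat \<Rightarrow> int) set" where
  "F_space p n = {1..n} \<rightarrow>\<^sub>E carrier (F_ring p)"

text \<open>The carrier of \<^term>\<open>F_ring p\<close> is the set of integers \<open>0, \<dots>, p - 1\<close>, with zero \<open>0\<close> and
  one \<open>1\<close>; so with integer entries the cube is literally a subset of \<^term>\<open>F_space p n\<close>.\<close>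

definition cube :: "nat \<Rightarrow> (nat \<Rightarrow> int) set" where
  "cube n = {1..n} \<rightarrow>\<^sub>E {0, 1}"

lemma cube_subset_F_space: "prime p \<Longrightarrow> cube n \<subseteq> F_space p n"
  unfolding cube_def F_space_def residue_ring_def
  by (intro PiE_mono) (use prime_gt_1_nat[of p] in auto)

definition cube_density :: "nat \<Rightarrow> (nat \<Rightarrow> int) set \<Rightarrow> real" where
  "cube_density n A = real (card A) / 2 ^ n"

text \<open>Only the values of \<open>\<phi>\<close> on \<^term>\<open>F_space p n\<close> matter.\<close>

definition mod_form :: "nat \<Rightarrow> nat \<Rightarrow> ((nat \<Rightarrow> int) \<Rightarrow> int) \<Rightarrow> bool" where
  "mod_form p n \<phi> \<longleftrightarrow>
    (\<exists>a \<in> {1..n} \<rightarrow> carrier (F_ring p). \<forall>x \<in> F_space p n.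
      \<phi> x = (\<Oplus>\<^bsub>F_ring p\<^esub>i\<in>{1..n}. a i \<otimes>\<^bsub>F_ring p\<^esub> x i))"

text \<open>The correlation depends only on the laws of the random variables \<open>X 1, \<dots>, X m\<close>, so these
  are given as probability mass functions.\<close>

definition cor :: "'d set \<Rightarrow> nat \<Rightarrow> (nat \<Rightarrow> 'd pmf) \<Rightarrow> real" where
  "cor D m X = (\<Sum>d\<in>D. \<Prod>j\<in>{1..m}. pmf (X j) d) - 1 / real (card D) ^ (m - 1)"

definition cor_on :: "'d set \<Rightarrow> nat \<Rightarrow> (nat \<Rightarrow> (nat \<Rightarrow> int) set) \<Rightarrow> ((nat \<Rightarrow> int) \<Rightarrow> 'd) \<Rightarrow> real" where
  "cor_on D m B F = cor D m (\<lambda>j. map_pmf F (pmf_of_set (B j)))"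

end

theory Submission
  imports Defs
begin

text \<open>
  Two observations drive the proof. First, by Fourier analysis and a Bessel inequality for almost
  orthogonal characters, the forms that are not nearly uniformly distributed on a fixed dense set
  lie in boundedly many Hamming balls of bounded radius, so there are only polynomially many.
  Second, fix a partition of the cube generated by boundedly many forms, and restrict to indices for
  which the laws of the partition label nearly agree. If the correlation of a tuple along \<open>\<phi>\<close> is too
  negative, then the law of \<open>\<phi>\<close> on some member of the tuple is not the one predicted from its label,
  so refining the partition by \<open>\<phi>\<close> increases the \<open>L\<^sup>2\<close> energy of that member; and \<open>\<phi>\<close> must also be
  biased on a different member, since otherwise all but one of the laws are nearly uniform and the
  correlation is near zero. Hence if many tuples are bad, some index occurs as that biased member
  together with a positive proportion of the others, and as it has only polynomially many biased
  forms, a single form \<open>\<phi>\<close> increases the energy of a polynomial proportion of the indices. The energy of a set of density \<open>\<delta>\<close> is at most \<open>1 / \<delta>\<close>, so this stops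
  after boundedly many refinements.
\<close>

section \<open>Frequencies and correlations\<close>

definition freq :: "'a set \<Rightarrow> ('a \<Rightarrow> 'b) \<Rightarrow> 'b \<Rightarrow> real" where
  "freq A f d = real (card {x \<in> A. f x = d}) / real (card A)"

lemma freq_nonneg: "0 \<le> freq A f d"
  by (simp add: freq_def)

lemma freq_le_1:
  assumes "finite A" shows "freq A f d \<le> 1"
proof -
  have "card {x \<in> A. f x = d} \<le> card A"
    using assms by (intro card_mono) auto
  then show ?thesis
    by (auto simp: freq_def divide_le_eq_1)
qed

lemma sum_freq:
  assumes "finite A" "A \<noteq> {}" "finite D" "f ` A \<subseteq> D"
  shows "(\<Sum>d\<in>D. freq A f d) = 1"
proof -
  have "(\<Sum>d\<in>D. card {x \<in> A. f x = d}) = card A"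
    using sum.group[of A D f "\<lambda>_. 1::nat"] assms by simp
  then have "(\<Sum>d\<in>D. real (card {x \<in> A. f x = d})) = real (card A)"
    by (metis of_nat_sum)
  then show ?thesis
    using assms by (simp add: freq_def flip: sum_divide_distrib)
qed

lemma freq_cong: "(\<And>x. x \<in> A \<Longrightarrow> f x = g x) \<Longrightarrow> freq A f d = freq A g d"
  unfolding freq_def by (metis (mono_tags, lifting) Collect_cong)

lemma pmf_map_pmf_of_set:
  assumes "finite A" "A \<noteq> {}"
  shows "pmf (map_pmf f (pmf_of_set A)) d = freq A f d"
proof -
  have "A \<inter> f -` {d} = {x \<in> A. f x = d}" by auto
  then show ?thesis
    using assms by (simp add: pmf_map measure_pmf_of_set freq_def)
qed

text \<open>Convexity at the uniform law: Bernoulli's inequality applied to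
  \<open>?k * r d = 1 + (?k * r d - 1)\<close> bounds each power by its tangent line, and the linear
  terms cancel on summation because the \<open>r d\<close> add up to 1.\<close>

lemma power_mean_lower_bound:
  fixes r :: "'d \<Rightarrow> real"
  assumes "finite D" "D \<noteq> {}" "\<And>d. d \<in> D \<Longrightarrow> 0 \<le> r d" "(\<Sum>d\<in>D. r d) = 1" "m \<ge> 1"
  shows "1 / real (card D) ^ (m - 1) \<le> (\<Sum>d\<in>D. r d ^ m)"
proof -
  let ?k = "real (card D)"
  have k: "?k > 0" using assms by (simp add: card_gt_0_iff)
  have "(1 + real m * (?k * r d - 1)) / ?k ^ m \<le> r d ^ m" if "d \<in> D" for d
  proof -
    have "1 + real m * (?k * r d - 1) \<le> (1 + (?k * r d - 1)) ^ m"
      using assms(3)[OF that] k by (intro Bernoulli_inequality) auto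
    then show ?thesis using k by (simp add: field_simps power_mult_distrib)
  qed
  then have "(\<Sum>d\<in>D. (1 + real m * (?k * r d - 1)) / ?k ^ m) \<le> (\<Sum>d\<in>D. r d ^ m)"
    by (rule sum_mono)
  also have "(\<Sum>d\<in>D. (1 + real m * (?k * r d - 1)) / ?k ^ m)
      = (?k + real m * (?k * (\<Sum>d\<in>D. r d) - ?k)) / ?k ^ m"
    by (simp add: sum.distrib sum_subtractf flip: sum_divide_distrib sum_distrib_left)
  also have "\<dots> = 1 / ?k ^ (m - 1)"
    using k assms(4,5) by (cases m) (auto simp: field_simps)
  finally show ?thesis .
qed

text \<open>A product of numbers in [0,1] is 1-Lipschitz in each factor, so moving every factor by
  at most \<open>\<eta>\<close> costs \<open>\<eta>\<close> per factor and per value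
  \<open>d\<close>.\<close>

lemma sum_prod_perturb:
  fixes q r :: "nat \<Rightarrow> 'd \<Rightarrow> real"
  assumes "\<And>j d. j \<in> J \<Longrightarrow> d \<in> D \<Longrightarrow> 0 \<le> q j d \<and> q j d \<le> 1"
    and "\<And>j d. j \<in> J \<Longrightarrow> d \<in> D \<Longrightarrow> 0 \<le> r j d \<and> r j d \<le> 1"
    and "\<And>j d. j \<in> J \<Longrightarrow> d \<in> D \<Longrightarrow> \<bar>q j d - r j d\<bar> \<le> \<eta>"
  shows "(\<Sum>d\<in>D. \<Prod>j\<in>J. r j d) - real (card D) * real (card J) * \<eta>
      \<le> (\<Sum>d\<in>D. \<Prod>j\<in>J. q j d)"
proof -
  have "(\<Prod>j\<in>J. r j d) - real (card J) * \<eta> \<le> (\<Prod>j\<in>J. q j d)" if d: "d \<in> D" for d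
  proof -
    have "norm ((\<Prod>j\<in>J. q j d) - (\<Prod>j\<in>J. r j d)) \<le> (\<Sum>j\<in>J. norm (q j d - r j d))"
      using assms d by (intro norm_prod_diff) auto
    also have "\<dots> \<le> (\<Sum>j\<in>J. \<eta>)" using assms d by (intro sum_mono) auto
    finally show ?thesis by (simp add: abs_le_iff)
  qed
  then have "(\<Sum>d\<in>D. (\<Prod>j\<in>J. r j d) - real (card J) * \<eta>) \<le> (\<Sum>d\<in>D. \<Prod>j\<in>J. q j d)"
    by (rule sum_mono)
  then show ?thesis by (simp add: sum_subtractf mult.assoc)
qed

text \<open>Replacing every law by the first one turns the sum into a sum of \<open>m\<close>-th
  powers, which the power mean bound controls. This is the first of two ways to exclude a very
  negative correlation.\<close>

lemma sum_prod_ge_if_all_close: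
  fixes q :: "nat \<Rightarrow> 'd \<Rightarrow> real"
  assumes "finite D" "D \<noteq> {}" "m \<ge> 1"
    and q01: "\<And>j d. j \<in> {1..m} \<Longrightarrow> d \<in> D \<Longrightarrow> 0 \<le> q j d \<and> q j d \<le> 1"
    and "(\<Sum>d\<in>D. q 1 d) = 1"
    and "\<And>j d. j \<in> {1..m} \<Longrightarrow> d \<in> D \<Longrightarrow> \<bar>q j d - q 1 d\<bar> \<le> \<eta>"
  shows "1 / real (card D) ^ (m - 1) - real (card D) * real m * \<eta>
      \<le> (\<Sum>d\<in>D. \<Prod>j\<in>{1..m}. q j d)"
proof -
  have "(\<Sum>d\<in>D. \<Prod>j\<in>{1..m}. q 1 d) - real (card D) * real (card {1..m}) * \<eta>
      \<le> (\<Sum>d\<in>D. \<Prod>j\<in>{1..m}. q j d)"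
    using assms by (intro sum_prod_perturb) auto
  moreover have "1 / real (card D) ^ (m - 1) \<le> (\<Sum>d\<in>D. q 1 d ^ m)"
    using assms by (intro power_mean_lower_bound) auto
  ultimately show ?thesis by simp
qed

text \<open>The second way: when \<open>m - 1\<close> laws are exactly uniform, the remaining law
  sums to 1 and the correlation vanishes, whatever that law is. The auxiliary family
  \<open>r\<close> is this ideal situation.\<close>

lemma sum_prod_ge_if_all_but_one_uniform:
  fixes q :: "nat \<Rightarrow> 'd \<Rightarrow> real"
  assumes "finite D" "D \<noteq> {}" "j0 \<in> {1..m}" "\<eta> \<ge> 0"
    and q01: "\<And>j d. j \<in> {1..m} \<Longrightarrow> d \<in> D \<Longrightarrow> 0 \<le> q j d \<and> q j d \<le> 1"
    and "(\<Sum>d\<in>D. q j0 d) = 1"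
    and "\<And>j d. j \<in> {1..m} - {j0} \<Longrightarrow> d \<in> D \<Longrightarrow> \<bar>q j d - 1 / real (card D)\<bar> \<le> \<eta>"
  shows "1 / real (card D) ^ (m - 1) - real (card D) * real m * \<eta>
      \<le> (\<Sum>d\<in>D. \<Prod>j\<in>{1..m}. q j d)"
proof -
  define r where "r j d = (if j = j0 then q j0 d else 1 / real (card D))" for j d
  have k: "card D \<ge> 1" using assms by (simp add: Suc_le_eq card_gt_0_iff)
  have "(\<Sum>d\<in>D. \<Prod>j\<in>{1..m}. r j d) - real (card D) * real (card {1..m}) * \<eta>
      \<le> (\<Sum>d\<in>D. \<Prod>j\<in>{1..m}. q j d)"
    using assms k by (intro sum_prod_perturb) (auto simp: r_def divide_le_eq_1)
  moreover have "(\<Prod>j\<in>{1..m}. r j d) = q j0 d * (1 / real (card D)) ^ (m - 1)" for d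
  proof -
    have "(\<Prod>j\<in>{1..m}. r j d) = r j0 d * (\<Prod>j\<in>{1..m}-{j0}. r j d)"
      using assms by (intro prod.remove) auto
    also have "(\<Prod>j\<in>{1..m}-{j0}. r j d) = (\<Prod>j\<in>{1..m}-{j0}. 1 / real (card D))"
      by (intro prod.cong) (auto simp: r_def)
    finally show ?thesis using assms(3) by (simp add: r_def power_one_over)
  qed
  ultimately show ?thesis
    using assms(6) by (simp add: power_one_over flip: sum_distrib_right sum_divide_distrib)
qed

section \<open>Energy of a set along a partition\<close>

text \<open>The conditional expectation of \<open>f\<close> given \<open>Y\<close>, for the uniform
  measure on \<open>\<Omega>\<close>.\<close>

definition cell_avg :: "'a set \<Rightarrow> ('a \<Rightarrow> 'b) \<Rightarrow> ('a \<Rightarrow> real) \<Rightarrow> 'a \<Rightarrow> real" where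
  "cell_avg \<Omega> Y f x = (\<Sum>z | z \<in> \<Omega> \<and> Y z = Y x. f z) / real (card {z \<in> \<Omega>. Y z = Y x})"

text \<open>The squared L2 norm of the conditional expectation, given \<open>Y\<close>, of the
  density of the uniform measure on \<open>A\<close> relative to the uniform measure on
  \<open>\<Omega>\<close>. That density is the indicator of \<open>A\<close> scaled by
  \<open>card \<Omega> / card A\<close>, which explains the normalisation.\<close>

definition energy :: "'a set \<Rightarrow> ('a \<Rightarrow> 'b) \<Rightarrow> 'a set \<Rightarrow> real" where
  "energy \<Omega> Y A =
     real (card \<Omega>) * (\<Sum>x\<in>\<Omega>. (cell_avg \<Omega> Y (indicator A) x)\<^sup>2) / (real (card A))\<^sup>2"

text \<open>The law of \<open>\<phi>\<close> on \<open>A\<close> that one would predict from the law of \<open>Y\<close> on \<open>A\<close>, if inside each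
  cell of \<open>Y\<close> the set \<open>A\<close> were independent of \<open>\<phi>\<close>.\<close>

definition pred_freq :: "'a set \<Rightarrow> ('a \<Rightarrow> 'b) \<Rightarrow> 'a set \<Rightarrow> ('a \<Rightarrow> 'c) \<Rightarrow> 'c \<Rightarrow> real" where
  "pred_freq \<Omega> Y A \<phi> d =
     (\<Sum>x | x \<in> \<Omega> \<and> \<phi> x = d. cell_avg \<Omega> Y (indicator A) x) / real (card A)"

text \<open>The defining property of conditional expectation, with \<open>h\<close> measurable for
  the partition: write the left side as a double sum over pairs in the same cell, exchange the
  order, and move \<open>h\<close> and the cell size from one point of the pair to the
  other.\<close>

lemma sum_cell_avg_mult:
  assumes "finite \<Omega>" and h: "\<And>x z. x \<in> \<Omega> \<Longrightarrow> z \<in> \<Omega> \<Longrightarrow> Y x = Y z \<Longrightarrow> h x = h z"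
  shows "(\<Sum>x\<in>\<Omega>. cell_avg \<Omega> Y f x * h x) = (\<Sum>x\<in>\<Omega>. f x * h x)"
proof -
  let ?N = "\<lambda>x. real (card {z \<in> \<Omega>. Y z = Y x})"
  have "(\<Sum>x\<in>\<Omega>. cell_avg \<Omega> Y f x * h x)
      = (\<Sum>x\<in>\<Omega>. \<Sum>z\<in>\<Omega>. if Y z = Y x then f z * h x / ?N x else 0)"
    unfolding cell_avg_def
    by (intro sum.cong refl)
      (simp add: assms(1) sum_divide_distrib sum_distrib_right flip: sum.inter_filter)
  also have "\<dots> = (\<Sum>z\<in>\<Omega>. \<Sum>x\<in>\<Omega>. if Y z = Y x then f z * h x / ?N x else 0)"
    by (rule sum.swap)
  also have "\<dots> = (\<Sum>z\<in>\<Omega>. \<Sum>x\<in>\<Omega>. if Y x = Y z then f z * h z / ?N z else 0)"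
  proof (intro sum.cong refl)
    fix z x assume "z \<in> \<Omega>" "x \<in> \<Omega>"
    then show "(if Y z = Y x then f z * h x / ?N x else 0)
        = (if Y x = Y z then f z * h z / ?N z else 0)"
      using h[of x z] by auto
  qed
  also have "\<dots> = (\<Sum>z\<in>\<Omega>. f z * h z)"
  proof (intro sum.cong refl)
    fix z assume "z \<in> \<Omega>"
    then have "?N z \<noteq> 0" using assms(1) by auto
    then show "(\<Sum>x\<in>\<Omega>. if Y x = Y z then f z * h z / ?N z else 0) = f z * h z"
      using assms(1) by (simp flip: sum.inter_filter)
  qed
  finally show ?thesis .
qed

lemma sum_power2_cell_avg:
  assumes "finite \<Omega>"
  shows "(\<Sum>x\<in>\<Omega>. (cell_avg \<Omega> Y f x)\<^sup>2) = (\<Sum>x\<in>\<Omega>. f x * cell_avg \<Omega> Y f x)"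
  unfolding power2_eq_square
  using sum_cell_avg_mult[OF assms, of Y "cell_avg \<Omega> Y f" f] by (simp add: cell_avg_def)

text \<open>Averaging over cells is an orthogonal projection and hence does not increase the L2
  norm, and the indicator of \<open>A\<close> has squared norm \<open>card A\<close>.\<close>

lemma energy_le:
  assumes "finite \<Omega>" "A \<subseteq> \<Omega>" "A \<noteq> {}"
  shows "energy \<Omega> Y A \<le> real (card \<Omega>) / real (card A)"
proof -
  let ?f = "indicator A :: _ \<Rightarrow> real" and ?g = "cell_avg \<Omega> Y (indicator A)"
  have "0 \<le> (\<Sum>x\<in>\<Omega>. (?f x - ?g x)\<^sup>2)" by (simp add: sum_nonneg)
  also have "\<dots> = (\<Sum>x\<in>\<Omega>. (?f x)\<^sup>2) - 2 * (\<Sum>x\<in>\<Omega>. ?f x * ?g x) + (\<Sum>x\<in>\<Omega>. (?g x)\<^sup>2)"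
    by (simp add: power2_diff sum.distrib sum_subtractf sum_distrib_left mult.assoc)
  finally have "(\<Sum>x\<in>\<Omega>. (?g x)\<^sup>2) \<le> (\<Sum>x\<in>\<Omega>. (?f x)\<^sup>2)"
    using sum_power2_cell_avg[OF assms(1), of Y ?f] by simp
  also have "\<dots> = real (card A)"
  proof -
    have "(\<Sum>x\<in>\<Omega>. (?f x)\<^sup>2) = (\<Sum>x\<in>\<Omega>. if x \<in> A then 1 else 0)"
      by (intro sum.cong) (auto simp: indicator_def)
    then show ?thesis using assms by (simp add: sum.If_cases Int_absorb1)
  qed
  finally have "real (card \<Omega>) * (\<Sum>x\<in>\<Omega>. (?g x)\<^sup>2) \<le> real (card \<Omega>) * real (card A)"
    by (simp add: mult_left_mono)
  moreover have "card A > 0" using assms finite_subset card_gt_0_iff by blast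
  ultimately show ?thesis by (simp add: energy_def field_simps power2_eq_square)
qed

lemma energy_nonneg: "energy \<Omega> Y A \<ge> 0"
  by (simp add: energy_def sum_nonneg)

text \<open>By Pythagoras the increment is the squared distance between the two projections of the
  indicator. The actual and the predicted frequency are pairings of these projections with the
  indicator \<open>h\<close> of the level set of \<open>\<phi>\<close>, so Cauchy-Schwarz applies.
  Labels are lists, so that refining by \<open>\<phi>\<close> does not change their type.\<close>

lemma energy_increment:
  assumes "finite \<Omega>" "A \<subseteq> \<Omega>" "A \<noteq> {}"
  shows "(freq A \<phi> d - pred_freq \<Omega> Y A \<phi> d)\<^sup>2
      \<le> energy \<Omega> (\<lambda>x. \<phi> x # Y x) A - energy \<Omega> Y A"
proof -
  let ?f = "indicator A :: _ \<Rightarrow> real" and ?g = "cell_avg \<Omega> Y (indicator A)"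
    and ?g' = "cell_avg \<Omega> (\<lambda>x. \<phi> x # Y x) (indicator A)"
  define h where "h x = (if \<phi> x = d then 1 else 0::real)" for x
  have "(\<Sum>x\<in>\<Omega>. ?g' x * ?g x) = (\<Sum>x\<in>\<Omega>. ?f x * ?g x)"
    by (rule sum_cell_avg_mult[OF assms(1)]) (simp add: cell_avg_def)
  then have pyth: "(\<Sum>x\<in>\<Omega>. (?g' x - ?g x)\<^sup>2) = (\<Sum>x\<in>\<Omega>. (?g' x)\<^sup>2) - (\<Sum>x\<in>\<Omega>. (?g x)\<^sup>2)"
    using sum_power2_cell_avg[OF assms(1), of Y ?f]
    by (simp add: power2_diff sum.distrib sum_subtractf mult.assoc flip: sum_distrib_left)
  \<comment> \<open>The refined label determines \<open>\<phi>\<close>, hence \<open>h\<close>, so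
    averaging over the refined cells preserves the pairing with \<open>h\<close>.\<close>
  have "(\<Sum>x\<in>\<Omega>. ?g' x * h x) = (\<Sum>x\<in>\<Omega>. ?f x * h x)"
    by (rule sum_cell_avg_mult[OF assms(1)]) (simp add: h_def)
  then have "(\<Sum>x\<in>\<Omega>. (?g' x - ?g x) * h x) = (\<Sum>x\<in>\<Omega>. ?f x * h x) - (\<Sum>x\<in>\<Omega>. ?g x * h x)"
    by (simp add: left_diff_distrib sum_subtractf)
  also have "(\<Sum>x\<in>\<Omega>. ?f x * h x) = real (card {x \<in> A. \<phi> x = d})"
  proof -
    have "(\<Sum>x\<in>\<Omega>. ?f x * h x) = (\<Sum>x\<in>\<Omega>. if x \<in> A \<and> \<phi> x = d then 1 else 0)"
      by (intro sum.cong) (auto simp: h_def indicator_def)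
    also have "\<dots> = real (card {x \<in> \<Omega>. x \<in> A \<and> \<phi> x = d})"
      using assms(1) by (simp flip: sum.inter_filter)
    also have "{x \<in> \<Omega>. x \<in> A \<and> \<phi> x = d} = {x \<in> A. \<phi> x = d}" using assms by auto
    finally show ?thesis .
  qed
  also have "(\<Sum>x\<in>\<Omega>. ?g x * h x) = (\<Sum>x | x \<in> \<Omega> \<and> \<phi> x = d. ?g x)"
    using assms(1) by (simp add: h_def if_distrib sum.inter_filter cong: if_cong)
  finally have eq: "freq A \<phi> d - pred_freq \<Omega> Y A \<phi> d
      = (\<Sum>x\<in>\<Omega>. (?g' x - ?g x) * h x) / real (card A)"
    by (simp add: freq_def pred_freq_def diff_divide_distrib)
  have "(\<Sum>x\<in>\<Omega>. (?g' x - ?g x) * h x)\<^sup>2 \<le> (\<Sum>x\<in>\<Omega>. (?g' x - ?g x)\<^sup>2) * (\<Sum>x\<in>\<Omega>. (h x)\<^sup>2)"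
    by (rule Cauchy_Schwarz_ineq_sum)
  also have "\<dots> \<le> (\<Sum>x\<in>\<Omega>. (?g' x - ?g x)\<^sup>2) * real (card \<Omega>)"
    using sum_mono[of \<Omega> "\<lambda>x. (h x)\<^sup>2" "\<lambda>_. 1"]
    by (intro mult_left_mono) (auto simp: h_def sum_nonneg)
  finally have "(\<Sum>x\<in>\<Omega>. (?g' x - ?g x) * h x)\<^sup>2
      \<le> real (card \<Omega>) * ((\<Sum>x\<in>\<Omega>. (?g' x)\<^sup>2) - (\<Sum>x\<in>\<Omega>. (?g x)\<^sup>2))"
    by (simp add: pyth mult.commute)
  then show ?thesis
    unfolding eq energy_def
    by (simp add: power_divide divide_right_mono right_diff_distrib flip: diff_divide_distrib)
qed

text \<open>The prediction sees \<open>A\<close> only through the law of \<open>Y\<close> on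
  \<open>A\<close>: it spreads each weight \<open>freq A Y y\<close> uniformly over the cell of
  \<open>y\<close>. The bound is therefore the l1 distance of two label laws, uniformly in
  \<open>\<phi>\<close> and \<open>d\<close>.\<close>

lemma pred_freq_diff_le:
  assumes "finite \<Omega>" "A \<subseteq> \<Omega>" "A' \<subseteq> \<Omega>"
  shows "\<bar>pred_freq \<Omega> Y A \<phi> d - pred_freq \<Omega> Y A' \<phi> d\<bar>
      \<le> (\<Sum>y\<in>Y ` \<Omega>. \<bar>freq A Y y - freq A' Y y\<bar>)"
proof -
  let ?N = "\<lambda>y. real (card {z \<in> \<Omega>. Y z = y})"
  let ?h = "\<lambda>y. \<bar>freq A Y y - freq A' Y y\<bar> / ?N y"
  have pf: "pred_freq \<Omega> Y B \<phi> d = (\<Sum>x | x \<in> \<Omega> \<and> \<phi> x = d. freq B Y (Y x) / ?N (Y x))"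
    if "B \<subseteq> \<Omega>" for B
  proof -
    have "cell_avg \<Omega> Y (indicator B) x / real (card B) = freq B Y (Y x) / ?N (Y x)" for x
    proof -
      have "(\<Sum>z | z \<in> \<Omega> \<and> Y z = Y x. indicator B z :: real)
          = real (card ({z \<in> \<Omega>. Y z = Y x} \<inter> B))"
        using assms(1) by (simp add: indicator_def sum.If_cases)
      also have "{z \<in> \<Omega>. Y z = Y x} \<inter> B = {z \<in> B. Y z = Y x}" using that by auto
      finally show ?thesis by (simp add: cell_avg_def freq_def)
    qed
    then show ?thesis by (simp add: pred_freq_def sum_divide_distrib)
  qed
  have "\<bar>pred_freq \<Omega> Y A \<phi> d - pred_freq \<Omega> Y A' \<phi> d\<bar>
      = \<bar>\<Sum>x | x \<in> \<Omega> \<and> \<phi> x = d. (freq A Y (Y x) - freq A' Y (Y x)) / ?N (Y x)\<bar>"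
    by (simp add: pf assms sum_subtractf diff_divide_distrib)
  also have "\<dots> \<le> (\<Sum>x | x \<in> \<Omega> \<and> \<phi> x = d. ?h (Y x))"
    by (rule order_trans[OF sum_abs]) simp
  also have "\<dots> \<le> (\<Sum>x\<in>\<Omega>. ?h (Y x))"
    using assms(1) by (intro sum_mono2) auto
  also have "\<dots> = (\<Sum>y\<in>Y ` \<Omega>. \<Sum>x | x \<in> \<Omega> \<and> Y x = y. ?h (Y x))"
    using assms(1) by (rule sum.image_gen)
  also have "\<dots> = (\<Sum>y\<in>Y ` \<Omega>. \<bar>freq A Y y - freq A' Y y\<bar>)"
  proof (intro sum.cong refl)
    fix y assume "y \<in> Y ` \<Omega>"
    then have "?N y \<noteq> 0" using assms(1) by auto
    moreover have "(\<Sum>x | x \<in> \<Omega> \<and> Y x = y. ?h (Y x)) = ?N y * ?h y" by simp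
    ultimately show "(\<Sum>x | x \<in> \<Omega> \<and> Y x = y. ?h (Y x)) = \<bar>freq A Y y - freq A' Y y\<bar>" by simp
  qed
  finally show ?thesis .
qed

section \<open>Biased forms\<close>

text \<open>Kept integer-valued, so that sums and differences of forms are exact; reduction modulo
  \<open>p\<close> is applied afterwards.\<close>

definition lform :: "nat \<Rightarrow> (nat \<Rightarrow> int) \<Rightarrow> (nat \<Rightarrow> int) \<Rightarrow> int" where
  "lform n a x = (\<Sum>i\<in>{1..n}. a i * x i)"

text \<open>The standard additive character of the integers modulo \<open>p\<close>, as a function
  on all integers.\<close>

definition add_char :: "nat \<Rightarrow> int \<Rightarrow> complex" where
  "add_char p k = cis (2 * pi * real_of_int k / real p)"

definition hamming :: "nat \<Rightarrow> (nat \<Rightarrow> int) \<Rightarrow> (nat \<Rightarrow> int) \<Rightarrow> nat" where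
  "hamming n a b = card {i \<in> {1..n}. a i \<noteq> b i}"

section \<open>Additive characters modulo \<open>p\<close> and Fourier inversion\<close>

lemma norm_add_char [simp]: "norm (add_char p k) = 1"
  by (simp add: add_char_def)

lemma add_char_0 [simp]: "add_char p 0 = 1"
  by (simp add: add_char_def)

lemma add_char_add: "add_char p (j + k) = add_char p j * add_char p k"
  by (simp add: add_char_def cis_mult add_divide_distrib distrib_left)

lemma cnj_add_char: "cnj (add_char p k) = add_char p (- k)"
  by (simp add: add_char_def cis_cnj)

lemma add_char_sum: "add_char p (\<Sum>i\<in>I. f i) = (\<Prod>i\<in>I. add_char p (f i))"
  by (induction I rule: infinite_finite_induct) (auto simp: add_char_add)

lemma add_char_power: "add_char p (int c * k) = add_char p k ^ c"
  by (induction c) (auto simp: distrib_right add_char_add)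

lemma add_char_eq_1_iff:
  assumes "p > 0" shows "add_char p k = 1 \<longleftrightarrow> int p dvd k"
proof
  assume "add_char p k = 1"
  then have "cos (2 * pi * real_of_int k / real p) = 1"
    by (simp add: add_char_def complex_eq_iff)
  then obtain j :: int where "2 * pi * real_of_int k / real p = real_of_int j * 2 * pi"
    by (auto simp: cos_one_2pi_int)
  then have "real_of_int k = real_of_int (j * int p)"
    using assms by (simp add: field_simps)
  then have "k = j * int p" by (simp only: of_int_eq_iff)
  then show "int p dvd k" by simp
next
  assume "int p dvd k"
  then obtain j where "k = int p * j" ..
  then have "2 * pi * real_of_int k / real p = 2 * pi * real_of_int j"
    using assms by simp
  then show "add_char p k = 1"
    by (simp add: add_char_def cis_multiple_2pi)
qed

lemma add_char_mod:
  assumes "p > 0" shows "add_char p (k mod int p) = add_char p k"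
proof -
  have "add_char p k = add_char p (k mod int p + int p * (k div int p))" by simp
  also have "\<dots> = add_char p (k mod int p)"
    by (subst add_char_add) (simp add: add_char_eq_1_iff[OF assms])
  finally show ?thesis by simp
qed

lemma sum_add_char:
  assumes "p > 0"
  shows "(\<Sum>c<p. add_char p (int c * k)) = (if int p dvd k then of_nat p else 0)"
proof (cases "int p dvd k")
  case True
  then have "add_char p (int c * k) = 1" for c
    by (simp add: add_char_eq_1_iff[OF assms])
  then show ?thesis using True by simp
next
  case False
  then have "add_char p k \<noteq> 1" by (simp add: add_char_eq_1_iff[OF assms])
  moreover have "add_char p k ^ p = 1"
    by (simp add: add_char_eq_1_iff[OF assms] flip: add_char_power)
  ultimately show ?thesis
    using False by (simp add: add_char_power geometric_sum)
qed

text \<open>Fourier inversion modulo \<open>p\<close>: detecting \<open>u x = d\<close> by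
  orthogonality of characters, the trivial character contributes exactly the uniform frequency
  \<open>1 / p\<close>, and fewer than \<open>p\<close> nontrivial ones remain, each weighted by
  \<open>1 / p\<close>.\<close>

lemma freq_near_uniform:
  assumes p: "p > 0" and A: "finite A" "A \<noteq> {}" and d: "d \<in> {0..int p - 1}" and "\<eta> \<ge> 0"
    and small: "\<And>c. c \<in> {1..<p} \<Longrightarrow>
      norm (\<Sum>x\<in>A. add_char p (int c * u x)) \<le> \<eta> * real (card A)"
  shows "\<bar>freq A (\<lambda>x. u x mod int p) d - 1 / real p\<bar> \<le> \<eta>"
proof -
  let ?T = "\<lambda>c. add_char p (- (int c * d)) * (\<Sum>x\<in>A. add_char p (int c * u x))"
  let ?N = "card {x \<in> A. u x mod int p = d}"
  have iff: "u x mod int p = d \<longleftrightarrow> int p dvd u x - d" for x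
    using d p mod_pos_pos_trivial[of d "int p"] by (auto simp: mod_eq_dvd_iff[symmetric])
  have "of_nat p * of_nat ?N = (\<Sum>x\<in>A. if int p dvd u x - d then of_nat p else (0::complex))"
    using A by (simp add: iff flip: sum.inter_filter)
  also have "\<dots> = (\<Sum>x\<in>A. \<Sum>c<p. add_char p (int c * (u x - d)))"
    by (simp add: sum_add_char[OF p])
  also have "\<dots> = (\<Sum>c<p. ?T c)"
    by (subst sum.swap)
      (simp add: sum_distrib_left right_diff_distrib flip: add_char_add)
  also have "\<dots> = ?T 0 + (\<Sum>c=1..<p. ?T c)"
    using p by (simp add: sum.atLeast_Suc_lessThan lessThan_atLeast0)
  finally have "of_nat p * of_nat ?N - of_nat (card A) = (\<Sum>c=1..<p. ?T c)"
    by simp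
  then have "norm (of_nat p * of_nat ?N - of_nat (card A) :: complex) \<le> (\<Sum>c=1..<p. norm (?T c))"
    by (simp add: norm_sum)
  also have "\<dots> \<le> (\<Sum>c=1..<p. \<eta> * real (card A))"
    by (intro sum_mono) (use small in \<open>auto simp: norm_mult\<close>)
  also have "\<dots> \<le> real p * (\<eta> * real (card A))"
    using p \<open>\<eta> \<ge> 0\<close> by (auto intro!: mult_right_mono)
  finally have "\<bar>real p * real ?N - real (card A)\<bar> \<le> real p * (\<eta> * real (card A))"
    by (metis (no_types, lifting) norm_of_real of_real_diff of_real_mult of_real_of_nat_eq)
  moreover have "card A > 0" using A by (simp add: card_gt_0_iff)
  ultimately show ?thesis
    using p by (simp add: freq_def abs_le_iff field_simps)
qed

section \<open>Character sums over the cube and large Fourier coefficients\<close>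

lemma sum_cube_add_char:
  "(\<Sum>x\<in>cube n. add_char p (lform n b x)) = (\<Prod>i\<in>{1..n}. 1 + add_char p (b i))"
proof -
  have "(\<Prod>i\<in>{1..n}. \<Sum>v\<in>{0,1::int}. add_char p (b i * v))
      = (\<Sum>x\<in>cube n. \<Prod>i\<in>{1..n}. add_char p (b i * x i))"
    unfolding cube_def by (intro prod_sum_PiE) auto
  then show ?thesis by (simp add: lform_def add_char_sum)
qed

text \<open>The norm equals 2 only when the character value is 1; since only finitely many residues
  occur, the nonzero ones stay below 2 by a uniform factor.\<close>

lemma norm_1_plus_add_char_bound:
  assumes "p > 0"
  obtains \<rho> where "0 \<le> \<rho>" "\<rho> < 1" "\<And>k. \<not> int p dvd k \<Longrightarrow> norm (1 + add_char p k) \<le> 2 * \<rho>"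
proof
  \<comment> \<open>Inserting 0 keeps the set non-empty when \<open>p = 1\<close> and makes its
    maximum nonnegative.\<close>
  define V where "V = insert 0 ((\<lambda>k. norm (1 + add_char p k) / 2) ` {1..<int p})"
  have fin: "finite V" by (simp add: V_def)
  show "0 \<le> Max V" by (rule Max_ge) (auto simp: fin V_def)
  have "norm (1 + add_char p k) < 2" if "k \<in> {1..<int p}" for k
  proof -
    have ne: "add_char p k \<noteq> 1"
      using that zdvd_not_zless[of k "int p"] by (simp add: add_char_eq_1_iff[OF assms])
    let ?t = "2 * pi * real_of_int k / real p"
    have "cos ?t \<noteq> 1"
    proof
      assume c: "cos ?t = 1"
      then have "sin ?t = 0" using sin_cos_squared_add[of ?t] by simp
      then show False using ne c by (simp add: add_char_def complex_eq_iff)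
    qed
    then have "cos ?t < 1" using cos_le_one[of ?t] by linarith
    moreover have "(norm (1 + add_char p k))\<^sup>2 = 2 + 2 * cos ?t"
      using sin_cos_squared_add[of ?t]
      by (simp add: cmod_power2 add_char_def power2_sum)
    ultimately have "(norm (1 + add_char p k))\<^sup>2 < 2\<^sup>2" by simp
    then show ?thesis by (rule power2_less_imp_less) simp
  qed
  then have "\<forall>v\<in>V. v < 1" by (auto simp: V_def)
  then show "Max V < 1" using fin by (simp add: V_def)
  show "norm (1 + add_char p k) \<le> 2 * Max V" if "\<not> int p dvd k" for k
  proof -
    have "k mod int p \<in> {1..<int p}"
      using that assms pos_mod_bound[of "int p" k] pos_mod_sign[of "int p" k]
      unfolding dvd_eq_mod_eq_0 atLeastLessThan_iff by linarith
    then have "norm (1 + add_char p (k mod int p)) / 2 \<le> Max V"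
      by (intro Max_ge fin) (auto simp: V_def)
    then show ?thesis by (simp add: add_char_mod[OF assms])
  qed
qed

lemma norm_sum_cube_add_char_le:
  assumes "0 \<le> \<rho>" and \<rho>: "\<And>k. \<not> int p dvd k \<Longrightarrow> norm (1 + add_char p k) \<le> 2 * \<rho>"
  shows "norm (\<Sum>x\<in>cube n. add_char p (lform n b x))
      \<le> 2 ^ n * \<rho> ^ card {i \<in> {1..n}. \<not> int p dvd b i}"
proof -
  have "norm (\<Sum>x\<in>cube n. add_char p (lform n b x)) = (\<Prod>i\<in>{1..n}. norm (1 + add_char p (b i)))"
    by (simp add: sum_cube_add_char flip: prod_norm)
  also have "\<dots> \<le> (\<Prod>i\<in>{1..n}. 2 * (if \<not> int p dvd b i then \<rho> else 1))"
  proof (intro prod_mono conjI)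
    fix i
    show "norm (1 + add_char p (b i)) \<le> 2 * (if \<not> int p dvd b i then \<rho> else 1)"
      using \<rho>[of "b i"] norm_triangle_ineq[of 1 "add_char p (b i)"] by auto
  qed auto
  also have "\<dots> = 2 ^ n * \<rho> ^ card {i \<in> {1..n}. \<not> int p dvd b i}"
    by (simp add: prod.distrib flip: prod.inter_filter)
  finally show ?thesis .
qed

lemma finite_cube [simp]: "finite (cube n)"
  by (simp add: cube_def finite_PiE)

lemma card_cube: "card (cube n) = 2 ^ n"
  by (simp add: cube_def card_PiE numeral_2_eq_2)

lemma F_space_eq: "F_space p n = {1..n} \<rightarrow>\<^sub>E {0..int p - 1}"
  by (simp add: F_space_def residue_ring_def)

lemma finite_F_space [simp]: "finite (F_space p n)"
  by (simp add: F_space_eq finite_PiE)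

text \<open>A Bessel inequality for almost orthogonal characters. Rotate the large coefficients to
  be positive, add them up, apply Cauchy-Schwarz over \<open>A\<close>, enlarge \<open>A\<close> to
  the cube and expand the square: the diagonal gives \<open>2 ^ n\<close> per element of
  \<open>S\<close>, and separation makes each off-diagonal term at most
  \<open>2 ^ n * \<rho> ^ L\<close>.\<close>

lemma separated_large_coeffs_bound:
  assumes p: "prime p" and c: "\<not> int p dvd c" and A: "A \<subseteq> cube n" "\<delta> * 2 ^ n \<le> real (card A)"
    and pos: "\<delta> > 0" "\<eta> > 0"
    and \<rho>: "0 \<le> \<rho>" "\<rho> < 1" "\<And>k. \<not> int p dvd k \<Longrightarrow> norm (1 + add_char p k) \<le> 2 * \<rho>"
    and L: "\<rho> ^ L \<le> \<eta>\<^sup>2 * \<delta> / 2"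
    and S: "S \<subseteq> F_space p n"
    and large: "\<And>a. a \<in> S \<Longrightarrow> \<eta> * real (card A) \<le> norm (\<Sum>x\<in>A. add_char p (c * lform n a x))"
    and sep: "\<And>a b. a \<in> S \<Longrightarrow> b \<in> S \<Longrightarrow> a \<noteq> b \<Longrightarrow> L \<le> hamming n a b"
  shows "real (card S) \<le> 2 / (\<eta>\<^sup>2 * \<delta>)"
proof -
  let ?s = "real (card S)"
  define W where "W a = (\<Sum>x\<in>A. add_char p (c * lform n a x))" for a
  \<comment> \<open>The phase that rotates \<open>W a\<close> onto its absolute value.\<close>
  define \<theta> where "\<theta> a = cnj (sgn (W a))" for a
  define F where "F x = (\<Sum>a\<in>S. \<theta> a * add_char p (c * lform n a x))" for x
  have finS: "finite S" using S finite_subset finite_F_space by blast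
  have \<theta>1: "norm (\<theta> a) \<le> 1" for a by (simp add: \<theta>_def norm_sgn)
  have \<theta>W: "\<theta> a * W a = of_real (norm (W a))" for a
  proof (cases "W a = 0")
    case False
    have "cnj (W a) * W a = of_real (norm (W a)) * of_real (norm (W a))"
      using complex_norm_square[of "W a"] by (simp add: power2_eq_square mult.commute)
    with False show ?thesis
      by (simp add: \<theta>_def sgn_eq)
  qed (simp add: \<theta>_def)
  have "(\<Sum>x\<in>A. F x) = (\<Sum>a\<in>S. of_real (norm (W a)))"
    unfolding F_def by (subst sum.swap) (simp add: \<theta>W flip: sum_distrib_left W_def)
  then have "norm (\<Sum>x\<in>A. F x) = (\<Sum>a\<in>S. norm (W a))"
    by (simp add: sum_nonneg flip: of_real_sum)
  moreover have "(\<Sum>a\<in>S. \<eta> * real (card A)) \<le> (\<Sum>a\<in>S. norm (W a))"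
    using large by (intro sum_mono) (simp add: W_def)
  ultimately have low: "?s * (\<eta> * real (card A)) \<le> norm (\<Sum>x\<in>A. F x)" by simp
  have "norm (\<Sum>x\<in>A. F x) \<le> (\<Sum>x\<in>A. norm (F x) * 1)" by (simp add: norm_sum)
  then have "(norm (\<Sum>x\<in>A. F x))\<^sup>2 \<le> (\<Sum>x\<in>A. norm (F x) * 1)\<^sup>2"
    by (intro power_mono) auto
  also have "\<dots> \<le> (\<Sum>x\<in>A. (norm (F x))\<^sup>2) * (\<Sum>x\<in>A. 1\<^sup>2)"
    by (rule Cauchy_Schwarz_ineq_sum)
  also have "\<dots> \<le> (\<Sum>x\<in>cube n. (norm (F x))\<^sup>2) * real (card A)"
    using A by (auto intro!: mult_right_mono sum_mono2)
  finally have up: "(norm (\<Sum>x\<in>A. F x))\<^sup>2 \<le> (\<Sum>x\<in>cube n. (norm (F x))\<^sup>2) * real (card A)" .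
  have off: "norm (\<Sum>x\<in>cube n. add_char p (lform n (\<lambda>i. c * (a i - b i)) x)) \<le> 2 ^ n * \<rho> ^ L"
    if ab: "a \<in> S" "b \<in> S" "a \<noteq> b" for a b
  proof -
    \<comment> \<open>The entries are reduced representatives and the prime \<open>p\<close> does
      not divide \<open>c\<close>, so the nonzero coefficients modulo \<open>p\<close> of the
      difference form are counted exactly by the Hamming distance.\<close>
    have "int p dvd c * (a i - b i) \<longleftrightarrow> a i = b i" if "i \<in> {1..n}" for i
    proof -
      have "a i \<in> {0..int p - 1}" "b i \<in> {0..int p - 1}"
        using ab S that by (auto simp: F_space_eq PiE_iff)
      then have "int p dvd a i - b i \<longleftrightarrow> a i = b i"
        using mod_pos_pos_trivial[of "a i" "int p"] mod_pos_pos_trivial[of "b i" "int p"]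
        by (auto simp: mod_eq_dvd_iff[symmetric])
      moreover have "prime (int p)" using p by simp
      ultimately show ?thesis using c prime_dvd_mult_iff by blast
    qed
    then have "{i \<in> {1..n}. \<not> int p dvd c * (a i - b i)} = {i \<in> {1..n}. a i \<noteq> b i}" by auto
    then have "norm (\<Sum>x\<in>cube n. add_char p (lform n (\<lambda>i. c * (a i - b i)) x))
        \<le> 2 ^ n * \<rho> ^ hamming n a b"
      using norm_sum_cube_add_char_le[OF \<rho>(1,3), of n "\<lambda>i. c * (a i - b i)"]
      by (simp add: hamming_def)
    also have "\<dots> \<le> 2 ^ n * \<rho> ^ L"
      using sep[OF ab] \<rho> by (intro mult_left_mono power_decreasing) auto
    finally show ?thesis .
  qed
  have "of_real (\<Sum>x\<in>cube n. (norm (F x))\<^sup>2) = (\<Sum>x\<in>cube n. F x * cnj (F x))"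
    by (simp add: complex_norm_square flip: of_real_power)
  also have "\<dots> = (\<Sum>x\<in>cube n. \<Sum>a\<in>S. \<Sum>b\<in>S.
      \<theta> a * cnj (\<theta> b) * add_char p (lform n (\<lambda>i. c * (a i - b i)) x))"
  proof (intro sum.cong refl)
    fix x
    have "lform n (\<lambda>i. c * (a i - b i)) x = c * lform n a x + - (c * lform n b x)" for a b
      by (simp add: lform_def sum_distrib_left algebra_simps flip: sum_subtractf)
    then show "F x * cnj (F x) = (\<Sum>a\<in>S. \<Sum>b\<in>S.
        \<theta> a * cnj (\<theta> b) * add_char p (lform n (\<lambda>i. c * (a i - b i)) x))"
      by (simp only: F_def cnj_sum sum_product complex_cnj_mult cnj_add_char add_char_add mult_ac)
  qed
  also have "\<dots> = (\<Sum>a\<in>S. \<Sum>b\<in>S. \<theta> a * cnj (\<theta> b) *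
      (\<Sum>x\<in>cube n. add_char p (lform n (\<lambda>i. c * (a i - b i)) x)))"
    unfolding sum_distrib_left
    by (rule trans[OF sum.swap], rule sum.cong[OF refl], rule sum.swap)
  finally have eq: "complex_of_real (\<Sum>x\<in>cube n. (norm (F x))\<^sup>2) = (\<Sum>a\<in>S. \<Sum>b\<in>S. \<theta> a * cnj (\<theta> b) *
      (\<Sum>x\<in>cube n. add_char p (lform n (\<lambda>i. c * (a i - b i)) x)))" .
  have "\<bar>\<Sum>x\<in>cube n. (norm (F x))\<^sup>2\<bar> = norm (\<Sum>a\<in>S. \<Sum>b\<in>S. \<theta> a * cnj (\<theta> b) *
      (\<Sum>x\<in>cube n. add_char p (lform n (\<lambda>i. c * (a i - b i)) x)))"
    unfolding eq[symmetric] norm_of_real ..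
  also have "\<dots> \<le> (\<Sum>a\<in>S. \<Sum>b\<in>S. (if a = b then 2 ^ n else 0) + 2 ^ n * \<rho> ^ L)"
  proof (intro sum_norm_le)
    fix a b assume ab: "a \<in> S" "b \<in> S"
    let ?G = "\<Sum>x\<in>cube n. add_char p (lform n (\<lambda>i. c * (a i - b i)) x)"
    have "norm (\<theta> a * cnj (\<theta> b) * ?G) \<le> 1 * 1 * norm ?G"
      unfolding norm_mult by (intro mult_mono) (auto simp: \<theta>1)
    also have "\<dots> \<le> (if a = b then 2 ^ n else 0) + 2 ^ n * \<rho> ^ L"
      using off[of a b] ab \<rho>(1) by (auto simp: lform_def card_cube norm_power)
    finally show "norm (\<theta> a * cnj (\<theta> b) * ?G) \<le> (if a = b then 2 ^ n else 0) + 2 ^ n * \<rho> ^ L" .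
  qed
  also have "\<dots> = 2 ^ n * (?s + ?s\<^sup>2 * \<rho> ^ L)"
    using finS by (simp add: sum.distrib algebra_simps power2_eq_square)
  also have "\<dots> \<le> 2 ^ n * (?s + ?s\<^sup>2 * (\<eta>\<^sup>2 * \<delta> / 2))"
    using L by (intro mult_left_mono add_left_mono) auto
  finally have "(\<Sum>x\<in>cube n. (norm (F x))\<^sup>2) \<le> 2 ^ n * (?s + ?s\<^sup>2 * (\<eta>\<^sup>2 * \<delta> / 2))"
    by simp
  then have "(?s * (\<eta> * real (card A)))\<^sup>2 \<le> 2 ^ n * (?s + ?s\<^sup>2 * (\<eta>\<^sup>2 * \<delta> / 2)) * real (card A)"
    using up power_mono[OF low, of 2] pos
    by (smt (verit) mult_nonneg_nonneg mult_right_mono of_nat_0_le_iff)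
  moreover have "0 < \<delta> * 2 ^ n" using pos by simp
  then have "real (card A) > 0" using A by linarith
  ultimately have "?s\<^sup>2 * \<eta>\<^sup>2 * real (card A) \<le> 2 ^ n * (?s + ?s\<^sup>2 * (\<eta>\<^sup>2 * \<delta> / 2))"
    by (simp add: power_mult_distrib power2_eq_square mult_ac)
  moreover have "?s\<^sup>2 * \<eta>\<^sup>2 * (\<delta> * 2 ^ n) \<le> ?s\<^sup>2 * \<eta>\<^sup>2 * real (card A)"
    using A by (intro mult_left_mono) auto
  ultimately have "?s\<^sup>2 * \<eta>\<^sup>2 * (\<delta> * 2 ^ n) \<le> 2 ^ n * (?s + ?s\<^sup>2 * (\<eta>\<^sup>2 * \<delta> / 2))"
    by linarith
  then have "2 ^ n * (?s\<^sup>2 * \<eta>\<^sup>2 * \<delta>) \<le> 2 ^ n * (?s + ?s\<^sup>2 * (\<eta>\<^sup>2 * \<delta> / 2))"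
    by (simp only: mult_ac)
  then have "?s\<^sup>2 * \<eta>\<^sup>2 * \<delta> \<le> ?s + ?s\<^sup>2 * (\<eta>\<^sup>2 * \<delta> / 2)"
    by simp
  \<comment> \<open>The choice of \<open>L\<close> makes the off-diagonal part at most half of the
    left side, where it is absorbed.\<close>
  then have "?s * (?s * (\<eta>\<^sup>2 * \<delta>)) \<le> ?s * 2"
    by (simp add: power2_eq_square algebra_simps)
  then have "?s * (\<eta>\<^sup>2 * \<delta>) \<le> 2" by (cases "card S = 0") auto
  then show ?thesis using pos by (simp add: field_simps)
qed

section \<open>Hamming balls, and the number of biased forms\<close>

lemma card_hamming_ball_le:
  assumes "a \<in> F_space p n"
  shows "card {b \<in> F_space p n. hamming n a b \<le> L} \<le> (1 + n * p) ^ L"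
proof (induction L)
  case 0
  have "b = a" if "b \<in> F_space p n" "hamming n a b = 0" for b
  proof
    fix i
    have "a i = b i" if "i \<in> {1..n}"
      using that \<open>hamming n a b = 0\<close> by (auto simp: hamming_def)
    then show "b i = a i"
      using assms \<open>b \<in> F_space p n\<close>
      by (cases "i \<in> {1..n}") (auto simp: F_space_eq PiE_iff extensional_def)
  qed
  then have "{b \<in> F_space p n. hamming n a b \<le> 0} \<subseteq> {a}" by auto
  then show ?case using card_mono[of "{a}"] by fastforce
next
  case (Suc L)
  let ?B = "\<lambda>L. {b \<in> F_space p n. hamming n a b \<le> L}"
  let ?U = "(\<lambda>(b, i, v). b(i := v)) ` (?B L \<times> {1..n} \<times> {0..int p - 1})"
  have "?B (Suc L) \<subseteq> ?B L \<union> ?U"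
  proof
    fix b assume b: "b \<in> ?B (Suc L)"
    show "b \<in> ?B L \<union> ?U"
    proof (cases "hamming n a b \<le> L")
      case False
      then have "card {i \<in> {1..n}. a i \<noteq> b i} \<noteq> 0" unfolding hamming_def by linarith
      then have "{i \<in> {1..n}. a i \<noteq> b i} \<noteq> {}" by (metis card.empty)
      then obtain i where i: "i \<in> {1..n}" "a i \<noteq> b i" by auto
      \<comment> \<open>Resetting one differing coordinate to its value in \<open>a\<close> lowers
        the distance by one; \<open>b\<close> is recovered from \<open>b'\<close> by one of at most
        \<open>n * p\<close> single-coordinate changes.\<close>
      define b' where "b' = b(i := a i)"
      have "{j \<in> {1..n}. a j \<noteq> b' j} = {j \<in> {1..n}. a j \<noteq> b j} - {i}" by (auto simp: b'_def)
      then have "hamming n a b' = hamming n a b - 1" using i by (simp add: hamming_def)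
      moreover have "b' \<in> F_space p n"
        using b assms i by (auto simp: b'_def F_space_eq PiE_iff extensional_def)
      ultimately have "b' \<in> ?B L" using b by auto
      moreover have "b = b'(i := b i)" by (simp add: b'_def)
      moreover have "b i \<in> {0..int p - 1}" using b i by (auto simp: F_space_eq PiE_iff)
      ultimately show ?thesis using i by (intro UnI2 image_eqI[where x = "(b', i, b i)"]) auto
    qed (use b in auto)
  qed
  then have "card (?B (Suc L)) \<le> card (?B L \<union> ?U)" by (intro card_mono) auto
  also have "\<dots> \<le> card (?B L) + card ?U" by (rule card_Un_le)
  also have "card ?U \<le> card (?B L \<times> {1..n} \<times> {0..int p - 1})" by (intro card_image_le) auto
  also have "\<dots> = card (?B L) * (n * p)" by (simp add: card_cartesian_product)
  finally have "card (?B (Suc L)) \<le> card (?B L) * (1 + n * p)" by simp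
  also have "\<dots> \<le> (1 + n * p) ^ L * (1 + n * p)" using Suc.IH by (rule mult_right_mono) simp
  finally show ?case by (simp add: mult.commute)
qed

text \<open>Greedy selection: a new point either lies within \<open>L\<close> of a chosen one or is
  far enough from all of them to be added.\<close>

lemma maximal_separated_subset:
  assumes "finite X"
  obtains S where "S \<subseteq> X"
    "\<And>a b. a \<in> S \<Longrightarrow> b \<in> S \<Longrightarrow> a \<noteq> b \<Longrightarrow> L \<le> hamming n a b"
    "\<And>x. x \<in> X \<Longrightarrow> \<exists>s\<in>S. hamming n s x \<le> L"
proof -
  have sym: "hamming n a b = hamming n b a" for a b
    unfolding hamming_def by (metis)
  have "\<exists>S\<subseteq>X. (\<forall>a\<in>S. \<forall>b\<in>S. a \<noteq> b \<longrightarrow> L \<le> hamming n a b) \<and> (\<forall>x\<in>X. \<exists>s\<in>S. hamming n s x \<le> L)"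
    using assms
  proof (induction X)
    case (insert x X)
    then obtain S where S: "S \<subseteq> X" "\<forall>a\<in>S. \<forall>b\<in>S. a \<noteq> b \<longrightarrow> L \<le> hamming n a b"
      "\<forall>x\<in>X. \<exists>s\<in>S. hamming n s x \<le> L" by blast
    show ?case
    proof (cases "\<exists>s\<in>S. hamming n s x \<le> L")
      case True
      then show ?thesis using S by (intro exI[of _ S]) auto
    next
      case False
      then have "\<forall>s\<in>S. L \<le> hamming n s x \<and> L \<le> hamming n x s"
        by (metis sym nat_le_linear)
      moreover have "hamming n x x \<le> L" by (simp add: hamming_def)
      ultimately show ?thesis using S by (intro exI[of _ "insert x S"]) auto
    qed
  qed auto
  then obtain S where "S \<subseteq> X" "\<forall>a\<in>S. \<forall>b\<in>S. a \<noteq> b \<longrightarrow> L \<le> hamming n a b"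
    "\<forall>x\<in>X. \<exists>s\<in>S. hamming n s x \<le> L" by blast
  then show ?thesis by (intro that[of S]) auto
qed

text \<open>By Fourier inversion a biased form has a large coefficient for some nontrivial multiple
  \<open>c\<close>. For each \<open>c\<close> a maximal separated set of such forms has bounded
  size, and the balls of radius \<open>L\<close> around it cover the rest. \<open>K\<close> and
  \<open>L\<close> are fixed before \<open>n\<close> and \<open>A\<close>.\<close>

lemma biased_forms_polynomially_many:
  fixes \<delta> \<eta> :: real
  assumes p: "prime p" and pos: "\<delta> > 0" "\<eta> > 0"
  shows "\<exists>K\<ge>0. \<exists>L. \<forall>n A. A \<subseteq> cube n \<longrightarrow> \<delta> * 2 ^ n \<le> real (card A) \<longrightarrow>
    real (card {a \<in> F_space p n. \<exists>d\<in>{0..int p - 1}.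
      \<bar>freq A (\<lambda>x. lform n a x mod int p) d - 1 / real p\<bar> > \<eta>}) \<le> K * (real n + 1) ^ L"
proof -
  have p0: "p > 0" using p prime_gt_0_nat by simp
  obtain \<rho> where \<rho>: "0 \<le> \<rho>" "\<rho> < 1" "\<And>k. \<not> int p dvd k \<Longrightarrow> norm (1 + add_char p k) \<le> 2 * \<rho>"
    using norm_1_plus_add_char_bound[OF p0] by blast
  \<comment> \<open>This \<open>L\<close> depends only on \<open>p\<close>, \<open>\<eta>\<close>
    and \<open>\<delta>\<close>; it serves both as separation and as ball radius.\<close>
  obtain L where L: "\<rho> ^ L \<le> \<eta>\<^sup>2 * \<delta> / 2"
    using real_arch_pow_inv[of "\<eta>\<^sup>2 * \<delta> / 2" \<rho>] \<rho> pos by (auto intro: less_imp_le)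
  define M where "M = 2 / (\<eta>\<^sup>2 * \<delta>)"
  have M: "M \<ge> 0" using pos by (simp add: M_def)
  show ?thesis
  proof (intro exI[of _ "real p * M * real p ^ L"] exI[of _ L] conjI allI impI)
    show "0 \<le> real p * M * real p ^ L" using M by simp
    fix n A assume A: "A \<subseteq> cube n" "\<delta> * 2 ^ n \<le> real (card A)"
    let ?B = "{a \<in> F_space p n. \<exists>d\<in>{0..int p - 1}.
      \<bar>freq A (\<lambda>x. lform n a x mod int p) d - 1 / real p\<bar> > \<eta>}"
    define X where "X c = {a \<in> F_space p n.
      \<eta> * real (card A) \<le> norm (\<Sum>x\<in>A. add_char p (int c * lform n a x))}" for c
    have finA: "finite A" using A finite_subset finite_cube by blast
    have "0 < \<delta> * 2 ^ n" using pos by simp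
    then have neA: "A \<noteq> {}" using A by auto
    have "?B \<subseteq> (\<Union>c\<in>{1..<p}. X c)"
    proof (rule subsetI, rule ccontr)
      fix a assume a: "a \<in> ?B" and n: "a \<notin> (\<Union>c\<in>{1..<p}. X c)"
      from n a have "norm (\<Sum>x\<in>A. add_char p (int c * lform n a x)) \<le> \<eta> * real (card A)"
        if "c \<in> {1..<p}" for c using that by (auto simp: X_def not_le intro: less_imp_le)
      then have "\<bar>freq A (\<lambda>x. lform n a x mod int p) d - 1 / real p\<bar> \<le> \<eta>"
        if "d \<in> {0..int p - 1}" for d
        using freq_near_uniform[OF p0 finA neA that, of \<eta> "lform n a"] pos by auto
      then show False using a by fastforce
    qed
    then have "card ?B \<le> card (\<Union>c\<in>{1..<p}. X c)" by (intro card_mono) (auto simp: X_def)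
    also have "\<dots> \<le> (\<Sum>c\<in>{1..<p}. card (X c))" by (rule card_UN_le) simp
    finally have "real (card ?B) \<le> (\<Sum>c\<in>{1..<p}. real (card (X c)))"
      by (simp flip: of_nat_sum)
    also have "\<dots> \<le> (\<Sum>c\<in>{1..<p}. M * (real p * (real n + 1)) ^ L)"
    proof (rule sum_mono)
      fix c assume c: "c \<in> {1..<p}"
      have finX: "finite (X c)" by (simp add: X_def)
      obtain S where S: "S \<subseteq> X c"
        "\<And>a b. a \<in> S \<Longrightarrow> b \<in> S \<Longrightarrow> a \<noteq> b \<Longrightarrow> L \<le> hamming n a b"
        "\<And>x. x \<in> X c \<Longrightarrow> \<exists>s\<in>S. hamming n s x \<le> L"
        using maximal_separated_subset[OF finX] by metis
      have "\<not> int p dvd int c" using c by (auto dest: dvd_imp_le)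
      then have cS: "real (card S) \<le> M"
        unfolding M_def using S
        by (intro separated_large_coeffs_bound[OF p _ A pos \<rho> L]) (auto simp: X_def)
      have "X c \<subseteq> (\<Union>s\<in>S. {b \<in> F_space p n. hamming n s b \<le> L})"
        using S(3) by (fastforce simp: X_def)
      moreover have finS: "finite S" using S(1) finX finite_subset by blast
      ultimately have "card (X c) \<le> card (\<Union>s\<in>S. {b \<in> F_space p n. hamming n s b \<le> L})"
        by (intro card_mono) auto
      also have "\<dots> \<le> (\<Sum>s\<in>S. card {b \<in> F_space p n. hamming n s b \<le> L})"
        using finS by (rule card_UN_le)
      also have "\<dots> \<le> (\<Sum>s\<in>S. (1 + n * p) ^ L)"
        using S(1) by (intro sum_mono card_hamming_ball_le) (auto simp: X_def)
      also have "\<dots> \<le> card S * (p * (n + 1)) ^ L"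
        using p0 by (auto intro!: mult_left_mono power_mono simp: algebra_simps)
      finally have "real (card (X c)) \<le> real (card S * (p * (n + 1)) ^ L)"
        by (rule of_nat_mono)
      also have "\<dots> = real (card S) * (real p * (real n + 1)) ^ L"
        by (simp add: algebra_simps)
      also have "\<dots> \<le> M * (real p * (real n + 1)) ^ L"
        using cS by (rule mult_right_mono) auto
      finally show "real (card (X c)) \<le> M * (real p * (real n + 1)) ^ L" .
    qed
    also have "\<dots> \<le> real p * (M * (real p * (real n + 1)) ^ L)"
      using M p0 by (auto intro!: mult_right_mono)
    finally show "real (card ?B) \<le> real p * M * real p ^ L * (real n + 1) ^ L"
      by (simp add: power_mult_distrib mult_ac)
  qed
qed

section \<open>Energy increment iteration\<close>

lemma pigeonhole_label:
  fixes lab :: "'i \<Rightarrow> 'l"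
  assumes "finite R" "R \<noteq> {}" "finite T" "lab ` R \<subseteq> T"
  obtains l where "l \<in> T" "card R \<le> card T * card {i \<in> R. lab i = l}"
proof -
  have T: "T \<noteq> {}" using assms by auto
  have "\<exists>l\<in>T. card R \<le> card T * card {i \<in> R. lab i = l}"
  proof (rule ccontr)
    assume "\<not> ?thesis"
    then have less: "card T * card {i \<in> R. lab i = l} < card R" if "l \<in> T" for l
      using that by force
    have "card T * card R = card T * (\<Sum>l\<in>T. card {i \<in> R. lab i = l})"
      using sum.group[of R T lab "\<lambda>_. 1::nat"] assms by simp
    also have "\<dots> = (\<Sum>l\<in>T. card T * card {i \<in> R. lab i = l})" by (simp add: sum_distrib_left)
    also have "\<dots> < (\<Sum>l\<in>T. card R)"
      using less assms T by (intro sum_strict_mono) auto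
    finally show False by simp
  qed
  then show ?thesis using that by blast
qed

text \<open>Round the frequency of each cell down to a multiple of \<open>1 / w\<close>. This gives
  at most \<open>w + 1\<close> values per cell, and indices with the same rounded law are kept
  together.\<close>

lemma pigeonhole_close_freqs:
  fixes Y :: "'a \<Rightarrow> 'b"
  assumes "finite \<Omega>" "finite R" "R \<noteq> {}" "\<And>i. i \<in> R \<Longrightarrow> A i \<subseteq> \<Omega>" "w > 0"
  obtains R' where "R' \<subseteq> R" "card R \<le> (w + 1) ^ card (Y ` \<Omega>) * card R'"
    "\<And>i i' y. i \<in> R' \<Longrightarrow> i' \<in> R' \<Longrightarrow> y \<in> Y ` \<Omega> \<Longrightarrow>
      \<bar>freq (A i) Y y - freq (A i') Y y\<bar> \<le> 1 / real w"
proof -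
  define r where "r i y = nat \<lfloor>real w * freq (A i) Y y\<rfloor>" for i y
  define lab where "lab i = restrict (r i) (Y ` \<Omega>)" for i
  have r: "real (r i y) \<le> real w * freq (A i) Y y \<and> real w * freq (A i) Y y < real (r i y) + 1"
    for i y
  proof -
    have "0 \<le> real w * freq (A i) Y y" by (simp add: freq_nonneg)
    then have "real (r i y) = of_int \<lfloor>real w * freq (A i) Y y\<rfloor>" by (simp add: r_def)
    then show ?thesis by linarith
  qed
  have "lab i \<in> Y ` \<Omega> \<rightarrow>\<^sub>E {0..w}" if "i \<in> R" for i
  proof -
    have "finite (A i)" using assms that finite_subset by blast
    then have "r i y \<le> w" for y
      using r[of i y] freq_le_1[of "A i" Y y] mult_left_mono[of "freq (A i) Y y" 1 "real w"] by simp
    then show ?thesis by (auto simp: lab_def)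
  qed
  then have "lab ` R \<subseteq> Y ` \<Omega> \<rightarrow>\<^sub>E {0..w}" by auto
  moreover have "finite (Y ` \<Omega> \<rightarrow>\<^sub>E {0..w})" using assms by (intro finite_PiE) auto
  ultimately obtain l where
    l: "card R \<le> card (Y ` \<Omega> \<rightarrow>\<^sub>E {0..w}) * card {i \<in> R. lab i = l}"
    using pigeonhole_label[OF assms(2,3)] by metis
  show ?thesis
  proof (rule that[of "{i \<in> R. lab i = l}"])
    show "card R \<le> (w + 1) ^ card (Y ` \<Omega>) * card {i \<in> R. lab i = l}"
      using l assms by (simp add: card_PiE)
    fix i i' y assume "i \<in> {i \<in> R. lab i = l}" "i' \<in> {i \<in> R. lab i = l}" and y: "y \<in> Y ` \<Omega>"
    then have "lab i y = lab i' y" by simp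
    then have "r i y = r i' y" using y by (simp add: lab_def)
    then have "\<bar>real w * freq (A i) Y y - real w * freq (A i') Y y\<bar> \<le> 1"
      using r[of i y] r[of i' y] by linarith
    then have "real w * \<bar>freq (A i) Y y - freq (A i') Y y\<bar> \<le> 1"
      by (simp add: abs_mult flip: right_diff_distrib)
    then show "\<bar>freq (A i) Y y - freq (A i') Y y\<bar> \<le> 1 / real w"
      using assms(5) by (simp add: field_simps)
  qed auto
qed

text \<open>All coordinates except \<open>j\<close> are chosen freely; since
  \<open>j \<noteq> j'\<close>, they already determine the set \<open>G (t j')\<close> from which
  the last one is taken.\<close>

lemma card_tuples_constrained_le:
  fixes G :: "'i \<Rightarrow> 'i set" and g :: real
  assumes "finite R" "j \<in> {1..m}" "j' \<in> {1..m}" "j \<noteq> j'"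
    and G: "\<And>i. i \<in> R \<Longrightarrow> G i \<subseteq> R \<and> real (card (G i)) \<le> g"
  shows "real (card {t \<in> {1..m} \<rightarrow>\<^sub>E R. t j \<in> G (t j')}) \<le> g * real (card R) ^ (m - 1)"
proof -
  let ?J = "{1..m} - {j}"
  let ?P = "?J \<rightarrow>\<^sub>E R"
  let ?S = "Sigma ?P (\<lambda>u. G (u j'))"
  let ?f = "\<lambda>t. (restrict t ?J, t j)"
  have finG: "finite (G i)" if "i \<in> R" for i using G[OF that] assms(1) finite_subset by blast
  have uR: "u j' \<in> R" if "u \<in> ?P" for u using that assms by (auto simp: PiE_iff)
  have finP: "finite ?P" using assms by (intro finite_PiE) auto
  have "inj_on ?f {t \<in> {1..m} \<rightarrow>\<^sub>E R. t j \<in> G (t j')}"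
  proof (rule inj_onI)
    fix t u assume tu: "t \<in> {t \<in> {1..m} \<rightarrow>\<^sub>E R. t j \<in> G (t j')}"
      "u \<in> {t \<in> {1..m} \<rightarrow>\<^sub>E R. t j \<in> G (t j')}" and eq: "?f t = ?f u"
    show "t = u"
    proof
      fix i
      show "t i = u i"
      proof (cases "i \<in> ?J")
        case True
        have "restrict t ?J = restrict u ?J" using eq by (simp only: prod.inject)
        then show ?thesis using True by (metis restrict_apply')
      next
        case False
        then show ?thesis using eq tu by (cases "i = j") (auto simp: PiE_iff extensional_def)
      qed
    qed
  qed
  moreover have "?f ` {t \<in> {1..m} \<rightarrow>\<^sub>E R. t j \<in> G (t j')} \<subseteq> ?S"
  proof (rule image_subsetI)
    fix t assume t: "t \<in> {t \<in> {1..m} \<rightarrow>\<^sub>E R. t j \<in> G (t j')}"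
    then have "restrict t ?J \<in> ?P" by (auto simp: PiE_iff)
    moreover have "restrict t ?J j' = t j'" using assms(3,4) by simp
    ultimately show "?f t \<in> ?S" using t by simp
  qed
  moreover have "finite ?S" using finP finG uR by (intro finite_SigmaI) auto
  ultimately have "card {t \<in> {1..m} \<rightarrow>\<^sub>E R. t j \<in> G (t j')} \<le> card ?S"
    by (rule card_inj_on_le)
  also have "card ?S = (\<Sum>u\<in>?P. card (G (u j')))"
    using finP finG uR by (intro card_SigmaI) auto
  finally have "real (card {t \<in> {1..m} \<rightarrow>\<^sub>E R. t j \<in> G (t j')}) \<le> (\<Sum>u\<in>?P. real (card (G (u j'))))"
    by (simp flip: of_nat_sum)
  also have "\<dots> \<le> (\<Sum>u\<in>?P. g)" using G uR by (intro sum_mono) auto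
  also have "\<dots> = g * real (card R) ^ (m - 1)"
    using assms by (simp add: card_PiE)
  finally show ?thesis .
qed

section \<open>Refinement rounds for an abstract family of forms\<close>

text \<open>The combinatorial input of the iteration: dense sets and finitely many forms, with the
  arithmetic of the cube entering only through the bound \<open>M\<close> on the number of biased
  forms.\<close>

locale dense_sets_with_forms =
  fixes \<Omega> :: "'a set" and \<Phi> :: "('a \<Rightarrow> 'd) set" and D :: "'d set"
    and I :: "nat set" and A :: "nat \<Rightarrow> 'a set" and m :: nat and \<delta> \<eta> M :: real
  assumes finite_\<Omega>: "finite \<Omega>" and finite_\<Phi>: "finite \<Phi>" and finite_D: "finite D"
    and D_nonempty: "D \<noteq> {}" and finite_I: "finite I"
    and form_values: "\<And>\<phi>. \<phi> \<in> \<Phi> \<Longrightarrow> \<phi> ` \<Omega> \<subseteq> D"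
    and A_subset: "\<And>i. i \<in> I \<Longrightarrow> A i \<subseteq> \<Omega>" and A_nonempty: "\<And>i. i \<in> I \<Longrightarrow> A i \<noteq> {}"
    and A_dense: "\<And>i. i \<in> I \<Longrightarrow> \<delta> * real (card \<Omega>) \<le> real (card (A i))"
    and m_ge_2: "m \<ge> 2" and \<delta>_pos: "\<delta> > 0" and \<eta>_pos: "\<eta> > 0" and M_pos: "M > 0"
    and few_biased: "\<And>i. i \<in> I \<Longrightarrow>
      real (card {\<phi> \<in> \<Phi>. \<exists>d\<in>D. \<bar>freq (A i) \<phi> d - 1 / real (card D)\<bar> > \<eta>}) \<le> M"
begin

definition biased :: "nat \<Rightarrow> ('a \<Rightarrow> 'd) set" where
  "biased i = {\<phi> \<in> \<Phi>. \<exists>d\<in>D. \<bar>freq (A i) \<phi> d - 1 / real (card D)\<bar> > \<eta>}"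

text \<open>The factor 3 pays for comparing two laws through their predictions: law to prediction,
  prediction to prediction, and prediction back to law, each within \<open>\<eta>\<close>.\<close>

definition good_tuple :: "(nat \<Rightarrow> nat) \<Rightarrow> bool" where
  "good_tuple t \<longleftrightarrow> (\<forall>\<phi>\<in>\<Phi>. 1 / real (card D) ^ (m - 1) - 3 * real (card D) * real m * \<eta>
      \<le> (\<Sum>d\<in>D. \<Prod>j\<in>{1..m}. freq (A (t j)) \<phi> d))"

definition good_set :: "real \<Rightarrow> nat set \<Rightarrow> bool" where
  "good_set \<epsilon> R \<longleftrightarrow>
     (1 - \<epsilon>) * real (card R) ^ m \<le> real (card {t \<in> {1..m} \<rightarrow>\<^sub>E R. good_tuple t})"

definition gains :: "('a \<Rightarrow> 'd list) \<Rightarrow> ('a \<Rightarrow> 'd) \<Rightarrow> nat \<Rightarrow> bool" where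
  "gains Y \<phi> i \<longleftrightarrow> energy \<Omega> Y (A i) + \<eta>\<^sup>2 \<le> energy \<Omega> (\<lambda>x. \<phi> x # Y x) (A i)"

lemma finite_A: "i \<in> I \<Longrightarrow> finite (A i)"
  using A_subset finite_\<Omega> finite_subset by blast

lemma sum_freq_form: "i \<in> I \<Longrightarrow> \<phi> \<in> \<Phi> \<Longrightarrow> (\<Sum>d\<in>D. freq (A i) \<phi> d) = 1"
  by (rule sum_freq[OF finite_A A_nonempty finite_D]) (use form_values A_subset in blast)+

text \<open>If no law strayed from its prediction, all laws would be within
  \<open>3 * \<eta>\<close> of the first; if \<open>\<phi>\<close> were unbiased at every position
  other than \<open>j\<close>, all laws but one would be nearly uniform. Each case contradicts
  badness through its own lower bound on the sum of products.\<close>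

lemma bad_tuple_witness:
  assumes R: "R \<subseteq> I" and t: "t \<in> {1..m} \<rightarrow>\<^sub>E R" "\<not> good_tuple t"
    and close: "\<And>i i' (\<phi> :: 'a \<Rightarrow> 'd) d. i \<in> R \<Longrightarrow> i' \<in> R \<Longrightarrow>
      \<bar>pred_freq \<Omega> Y (A i) \<phi> d - pred_freq \<Omega> Y (A i') \<phi> d\<bar> \<le> \<eta>"
  shows "\<exists>j\<in>{1..m}. \<exists>j'\<in>{1..m}. j \<noteq> j' \<and> (\<exists>\<phi>\<in>biased (t j'). gains Y \<phi> (t j))"
proof -
  obtain \<phi> where \<phi>: "\<phi> \<in> \<Phi>" and bad: "(\<Sum>d\<in>D. \<Prod>j\<in>{1..m}. freq (A (t j)) \<phi> d)
      < 1 / real (card D) ^ (m - 1) - real (card D) * real m * (3 * \<eta>)"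
    using t(2) by (auto simp: good_tuple_def not_le mult_ac)
  have tR: "t j \<in> R" if "j \<in> {1..m}" for j using t(1) that by (auto simp: PiE_iff)
  have tI: "t j \<in> I" if "j \<in> {1..m}" for j using tR[OF that] R by auto
  have q01: "0 \<le> freq (A (t j)) \<phi> d \<and> freq (A (t j)) \<phi> d \<le> 1" if "j \<in> {1..m}" for j d
    using freq_nonneg[of "A (t j)" \<phi> d] freq_le_1[OF finite_A[OF tI[OF that]], of \<phi> d] by blast
  have "\<exists>j\<in>{1..m}. \<exists>d. \<bar>freq (A (t j)) \<phi> d - pred_freq \<Omega> Y (A (t j)) \<phi> d\<bar> > \<eta>"
  proof (rule ccontr)
    assume "\<not> ?thesis"
    then have n: "\<bar>freq (A (t j)) \<phi> d - pred_freq \<Omega> Y (A (t j)) \<phi> d\<bar> \<le> \<eta>" if "j \<in> {1..m}" for j d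
      using that by (meson not_le)
    have "\<bar>freq (A (t j)) \<phi> d - freq (A (t 1)) \<phi> d\<bar> \<le> 3 * \<eta>" if "j \<in> {1..m}" for j d
      using n[OF that, of d] n[of 1 d] close[OF tR[OF that] tR[of 1], of \<phi> d] m_ge_2
      by fastforce
    then have "1 / real (card D) ^ (m - 1) - real (card D) * real m * (3 * \<eta>)
        \<le> (\<Sum>d\<in>D. \<Prod>j\<in>{1..m}. freq (A (t j)) \<phi> d)"
      using m_ge_2 sum_freq_form[OF tI[of 1] \<phi>] q01
      by (intro sum_prod_ge_if_all_close finite_D D_nonempty) auto
    then show False using bad by linarith
  qed
  then obtain j d where j: "j \<in> {1..m}"
    and d: "\<bar>freq (A (t j)) \<phi> d - pred_freq \<Omega> Y (A (t j)) \<phi> d\<bar> > \<eta>" by blast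
  have "\<eta>\<^sup>2 \<le> (freq (A (t j)) \<phi> d - pred_freq \<Omega> Y (A (t j)) \<phi> d)\<^sup>2"
    using d \<eta>_pos by (metis abs_ge_zero less_eq_real_def power2_abs power_mono)
  also have "\<dots> \<le> energy \<Omega> (\<lambda>x. \<phi> x # Y x) (A (t j)) - energy \<Omega> Y (A (t j))"
    by (intro energy_increment finite_\<Omega> A_subset A_nonempty tI j)
  finally have gain: "gains Y \<phi> (t j)" by (simp add: gains_def)
  have "\<exists>j'\<in>{1..m} - {j}. \<phi> \<in> biased (t j')"
  proof (rule ccontr)
    assume "\<not> ?thesis"
    then have "\<bar>freq (A (t j')) \<phi> d - 1 / real (card D)\<bar> \<le> \<eta>"
      if "j' \<in> {1..m} - {j}" "d \<in> D" for j' d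
      using that \<phi> unfolding biased_def by (auto simp: not_less)
    then have u: "\<bar>freq (A (t j')) \<phi> d - 1 / real (card D)\<bar> \<le> 3 * \<eta>"
      if "j' \<in> {1..m} - {j}" "d \<in> D" for j' d
      using that \<eta>_pos by fastforce
    have "1 / real (card D) ^ (m - 1) - real (card D) * real m * (3 * \<eta>)
        \<le> (\<Sum>d\<in>D. \<Prod>j\<in>{1..m}. freq (A (t j)) \<phi> d)"
      using u q01 \<eta>_pos sum_freq_form[OF tI[OF j] \<phi>]
      by (intro sum_prod_ge_if_all_but_one_uniform[OF finite_D D_nonempty j]) auto
    then show False using bad by linarith
  qed
  then obtain j' where "j' \<in> {1..m} - {j}" and b: "\<phi> \<in> biased (t j')" ..
  then have j': "j' \<in> {1..m}" "j \<noteq> j'" by auto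
  show ?thesis
    by (rule bexI[OF _ j], rule bexI[OF _ j'(1)], intro conjI j'(2) bexI[of _ \<phi>] gain b)
qed

text \<open>Double counting: if every form gains on few indices, then each index \<open>i'\<close>
  has a small set \<open>G i'\<close> of indices gaining through a form biased on \<open>i'\<close>.
  Every bad tuple has some \<open>t j\<close> in \<open>G (t j')\<close>, so the bad tuples are too
  few.\<close>

lemma exists_popular_gain:
  assumes R: "R \<subseteq> I" and "\<epsilon> > 0" and bad: "\<not> good_set \<epsilon> R"
    and close: "\<And>i i' (\<phi> :: 'a \<Rightarrow> 'd) d. i \<in> R \<Longrightarrow> i' \<in> R \<Longrightarrow>
      \<bar>pred_freq \<Omega> Y (A i) \<phi> d - pred_freq \<Omega> Y (A i') \<phi> d\<bar> \<le> \<eta>"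
  shows "\<exists>\<phi>\<in>\<Phi>. real (card R) \<le> (real m)\<^sup>2 * M / \<epsilon> * real (card {i \<in> R. gains Y \<phi> i})"
proof (rule ccontr)
  assume unpopular: "\<not> ?thesis"
  \<comment> \<open>The threshold for which \<open>m\<^sup>2\<close> pairs of positions,
    \<open>M\<close> biased forms and \<open>X\<close> gains per form account for a proportion
    \<open>\<epsilon>\<close> of the tuples.\<close>
  define X where "X = \<epsilon> * real (card R) / ((real m)\<^sup>2 * M)"
  have X0: "X \<ge> 0" using \<open>\<epsilon> > 0\<close> M_pos by (simp add: X_def)
  have X: "real (card {i \<in> R. gains Y \<phi> i}) \<le> X" if "\<phi> \<in> \<Phi>" for \<phi>
  proof -
    have "(real m)\<^sup>2 * M / \<epsilon> * real (card {i \<in> R. gains Y \<phi> i}) < real (card R)"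
      using unpopular that by (meson not_le)
    then show ?thesis using \<open>\<epsilon> > 0\<close> M_pos m_ge_2 by (simp add: X_def field_simps)
  qed
  have finR: "finite R" using R finite_I finite_subset by blast
  define G where "G i' = {i \<in> R. \<exists>\<phi>\<in>biased i'. gains Y \<phi> i}" for i'
  have G: "G i' \<subseteq> R \<and> real (card (G i')) \<le> M * X" if "i' \<in> R" for i'
  proof
    have fb: "finite (biased i')" using finite_\<Phi> by (simp add: biased_def)
    have "G i' = (\<Union>\<phi>\<in>biased i'. {i \<in> R. gains Y \<phi> i})" by (auto simp: G_def)
    then have "card (G i') \<le> (\<Sum>\<phi>\<in>biased i'. card {i \<in> R. gains Y \<phi> i})"
      using card_UN_le[OF fb] by simp
    then have "real (card (G i')) \<le> (\<Sum>\<phi>\<in>biased i'. real (card {i \<in> R. gains Y \<phi> i}))"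
      by (simp flip: of_nat_sum)
    also have "\<dots> \<le> (\<Sum>\<phi>\<in>biased i'. X)" using X by (intro sum_mono) (auto simp: biased_def)
    also have "\<dots> \<le> M * X"
      using few_biased[of i'] R that X0 by (auto simp: biased_def intro!: mult_right_mono)
    finally show "real (card (G i')) \<le> M * X" .
  qed (auto simp: G_def)
  let ?T = "{1..m} \<rightarrow>\<^sub>E R"
  let ?P = "{(j, j') \<in> {1..m} \<times> {1..m}. j \<noteq> j'}"
  let ?E = "\<lambda>(j, j'). {t \<in> ?T. t j \<in> G (t j')}"
  have finT: "finite ?T" using finR by (intro finite_PiE) auto
  have finP: "finite ?P" by (rule finite_subset[of _ "{1..m} \<times> {1..m}"]) auto
  have cardP: "card ?P \<le> m * m"
  proof -
    have "card ?P \<le> card ({1..m} \<times> {1..m})" by (intro card_mono) auto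
    then show ?thesis by (simp add: card_cartesian_product)
  qed
  have "{t \<in> ?T. \<not> good_tuple t} \<subseteq> (\<Union>q\<in>?P. ?E q)"
  proof
    fix t assume t: "t \<in> {t \<in> ?T. \<not> good_tuple t}"
    then obtain j j' \<phi> where
      "j \<in> {1..m}" "j' \<in> {1..m}" "j \<noteq> j'" "\<phi> \<in> biased (t j')" "gains Y \<phi> (t j)"
      using bad_tuple_witness[OF R _ _ close, of t] by blast
    moreover have "t j \<in> R" using t \<open>j \<in> {1..m}\<close> by (auto simp: PiE_iff)
    ultimately show "t \<in> (\<Union>q\<in>?P. ?E q)"
      using t by (intro UN_I[of "(j, j')"]) (auto simp: G_def)
  qed
  then have "card {t \<in> ?T. \<not> good_tuple t} \<le> card (\<Union>q\<in>?P. ?E q)"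
    using finT finP by (intro card_mono finite_UN_I) auto
  also have "\<dots> \<le> (\<Sum>q\<in>?P. card (?E q))" using finP by (rule card_UN_le)
  finally have "real (card {t \<in> ?T. \<not> good_tuple t}) \<le> (\<Sum>q\<in>?P. real (card (?E q)))"
    by (simp flip: of_nat_sum)
  also have "\<dots> \<le> (\<Sum>q\<in>?P. M * X * real (card R) ^ (m - 1))"
    using card_tuples_constrained_le[where G = G, OF finR _ _ _ G] by (intro sum_mono) auto
  also have "\<dots> \<le> real (m * m) * (M * X * real (card R) ^ (m - 1))"
    unfolding sum_constant using cardP M_pos X0 by (intro mult_right_mono of_nat_mono) auto
  also have "\<dots> = \<epsilon> * (real (card R) * real (card R) ^ (m - 1))"
    using M_pos m_ge_2 by (simp add: X_def power2_eq_square)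
  also have "real (card R) * real (card R) ^ (m - 1) = real (card R) ^ m"
    using m_ge_2 by (simp flip: power_Suc)
  finally have "real (card {t \<in> ?T. \<not> good_tuple t}) \<le> \<epsilon> * real (card R) ^ m" .
  moreover have "real (card {t \<in> ?T. good_tuple t}) + real (card {t \<in> ?T. \<not> good_tuple t})
      = real (card R) ^ m"
  proof -
    have "card {t \<in> ?T. good_tuple t} + card {t \<in> ?T. \<not> good_tuple t}
        = card ({t \<in> ?T. good_tuple t} \<union> {t \<in> ?T. \<not> good_tuple t})"
      using finT by (intro card_Un_disjoint[symmetric]) auto
    also have "{t \<in> ?T. good_tuple t} \<union> {t \<in> ?T. \<not> good_tuple t} = ?T" by auto
    also have "card ?T = card R ^ m" by (simp add: card_PiE)
    finally have "real (card {t \<in> ?T. good_tuple t} + card {t \<in> ?T. \<not> good_tuple t})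
        = real (card R ^ m)" by (rule arg_cong)
    then show ?thesis by (simp only: of_nat_add of_nat_power)
  qed
  ultimately have "good_set \<epsilon> R" by (simp add: good_set_def algebra_simps)
  then show False using bad by simp
qed

text \<open>Induction on the number \<open>k\<close> of refinements still affordable before the
  energy would exceed \<open>1 / \<delta>\<close>. \<open>W\<close> bounds the number of cells even
  after \<open>k\<close> more refinements, so one accuracy \<open>w\<close> serves all rounds. The
  factor \<open>c\<close> is the loss per round: equalising label laws, then passing to the indices
  where a popular form gains.\<close>

lemma good_subset_from_energy:
  fixes W w :: nat and \<epsilon> :: real and Y :: "'a \<Rightarrow> 'd list"
  defines "c \<equiv> real (w + 1) ^ W * max 1 ((real m)\<^sup>2 * M / \<epsilon>)"
  assumes "\<epsilon> > 0" "w > 0" and w: "real W \<le> real w * \<eta>"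
    and "R \<subseteq> I" "R \<noteq> {}" "card (Y ` \<Omega>) * card D ^ k \<le> W"
    and "\<And>i. i \<in> R \<Longrightarrow> energy \<Omega> Y (A i) > 1 / \<delta> - real k * \<eta>\<^sup>2"
  shows "\<exists>R'\<subseteq>R. good_set \<epsilon> R' \<and> real (card R) \<le> c ^ k * real (card R')"
  using assms(5-)
proof (induction k arbitrary: R Y)
  \<comment> \<open>No refinement is left: the hypothesis puts the energy above
    \<open>1 / \<delta>\<close>, which density forbids.\<close>
  case 0
  then obtain i where i: "i \<in> R" "i \<in> I" by auto
  have cA: "real (card (A i)) > 0" using i finite_A A_nonempty by (simp add: card_gt_0_iff)
  have "energy \<Omega> Y (A i) \<le> real (card \<Omega>) / real (card (A i))"
    using i finite_\<Omega> A_subset A_nonempty by (intro energy_le) auto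
  also have "\<dots> \<le> 1 / \<delta>" using A_dense[OF i(2)] \<delta>_pos cA by (simp add: field_simps)
  finally show ?case using 0(4)[OF i(1)] by simp
next
  case (Suc k)
  let ?V = "real (w + 1) ^ W" and ?Q = "max 1 ((real m)\<^sup>2 * M / \<epsilon>)"
  have V1: "?V \<ge> 1" and Q1: "?Q \<ge> 1" by (auto simp: one_le_power)
  have c1: "c \<ge> 1" unfolding c_def using mult_mono[OF V1 Q1] by simp
  have finR: "finite R" using Suc.prems(1) finite_I finite_subset by blast
  have D1: "card D \<ge> 1" using finite_D D_nonempty by (simp add: Suc_le_eq card_gt_0_iff)
  have YW: "card (Y ` \<Omega>) \<le> W"
    using Suc.prems(3) D1 by (metis le_trans mult_le_mono2 nat_mult_1_right one_le_power)
  have RA: "\<And>i. i \<in> R \<Longrightarrow> A i \<subseteq> \<Omega>" using Suc.prems(1) A_subset by auto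
  obtain R1 where R1: "R1 \<subseteq> R" "card R \<le> (w + 1) ^ card (Y ` \<Omega>) * card R1"
    and cl: "\<And>i i' y. i \<in> R1 \<Longrightarrow> i' \<in> R1 \<Longrightarrow> y \<in> Y ` \<Omega> \<Longrightarrow>
      \<bar>freq (A i) Y y - freq (A i') Y y\<bar> \<le> 1 / real w"
    using pigeonhole_close_freqs[where A = A and Y = Y,
        OF finite_\<Omega> finR Suc.prems(2) RA \<open>w > 0\<close>] by blast
  have "real (card R) \<le> real ((w + 1) ^ card (Y ` \<Omega>) * card R1)" using R1(2) by (rule of_nat_mono)
  also have "\<dots> \<le> ?V * real (card R1)"
    using YW by (auto intro!: mult_right_mono power_increasing)
  finally have RV: "real (card R) \<le> ?V * real (card R1)" .
  have close: "\<bar>pred_freq \<Omega> Y (A i) \<phi> d - pred_freq \<Omega> Y (A i') \<phi> d\<bar> \<le> \<eta>"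
    if "i \<in> R1" "i' \<in> R1" for i i' d and \<phi> :: "'a \<Rightarrow> 'd"
  proof -
    have "\<bar>pred_freq \<Omega> Y (A i) \<phi> d - pred_freq \<Omega> Y (A i') \<phi> d\<bar>
        \<le> (\<Sum>y\<in>Y ` \<Omega>. \<bar>freq (A i) Y y - freq (A i') Y y\<bar>)"
      using that R1(1) RA finite_\<Omega> by (intro pred_freq_diff_le) auto
    also have "\<dots> \<le> (\<Sum>y\<in>Y ` \<Omega>. 1 / real w)" using that cl by (intro sum_mono) auto
    also have "\<dots> \<le> real W / real w" using YW by (simp add: divide_right_mono)
    also have "\<dots> \<le> \<eta>" using w \<open>w > 0\<close> by (simp add: field_simps)
    finally show ?thesis .
  qed
  show ?case
  proof (cases "good_set \<epsilon> R1")
    case True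
    \<comment> \<open>Stopping early costs only the pigeonhole factor; the maximum with 1 in
      \<open>c\<close> ensures that this fits the budget for \<open>Suc k\<close> rounds.\<close>
    have "?V \<le> c * c ^ k"
      using mult_mono[of ?V c 1 "c ^ k"] c1 one_le_power[OF c1, of k] mult_left_mono[OF Q1, of ?V]
      by (simp add: c_def)
    then have "?V * real (card R1) \<le> c ^ Suc k * real (card R1)"
      by (intro mult_right_mono) auto
    then show ?thesis using True R1(1) RV by (intro exI[of _ R1]) linarith
  next
    case False
    obtain \<phi> where \<phi>: "\<phi> \<in> \<Phi>"
      and pop: "real (card R1) \<le> (real m)\<^sup>2 * M / \<epsilon> * real (card {i \<in> R1. gains Y \<phi> i})"
      using exists_popular_gain[OF _ \<open>\<epsilon> > 0\<close> False close] R1(1) Suc.prems(1) by blast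
    define R2 where "R2 = {i \<in> R1. gains Y \<phi> i}"
    have "real (card R1) \<le> ?Q * real (card R2)"
      using pop mult_right_mono[OF max.cobounded2, of "real (card R2)" "(real m)\<^sup>2 * M / \<epsilon>" 1]
      unfolding R2_def by linarith
    then have "?V * real (card R1) \<le> ?V * (?Q * real (card R2))"
      by (intro mult_left_mono) auto
    then have R2c: "real (card R) \<le> c * real (card R2)"
      using RV unfolding c_def mult.assoc by linarith
    have R2R: "R2 \<subseteq> R" using R1(1) by (auto simp: R2_def)
    have "card R > 0" using finR Suc.prems(2) by (simp add: card_gt_0_iff)
    then have R2ne: "R2 \<noteq> {}" using R2c by auto
    let ?Y = "\<lambda>x. \<phi> x # Y x"
    \<comment> \<open>Refining by \<open>\<phi>\<close> multiplies the number of cells by at most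
      \<open>card D\<close>, which uses up one of the reserved factors in \<open>W\<close>.\<close>
    have "?Y ` \<Omega> \<subseteq> (\<lambda>(d, y). d # y) ` (D \<times> Y ` \<Omega>)" using form_values[OF \<phi>] by auto
    then have "card (?Y ` \<Omega>) \<le> card ((\<lambda>(d, y). d # y) ` (D \<times> Y ` \<Omega>))"
      using finite_D finite_\<Omega> by (intro card_mono) auto
    also have "\<dots> \<le> card D * card (Y ` \<Omega>)"
      using finite_D finite_\<Omega> card_image_le[of "D \<times> Y ` \<Omega>" "\<lambda>(d, y). d # y"]
      by (simp add: card_cartesian_product)
    finally have "card (?Y ` \<Omega>) * card D ^ k \<le> card D * card (Y ` \<Omega>) * card D ^ k"
      by (rule mult_right_mono) simp
    also have "\<dots> \<le> W" using Suc.prems(3) by (simp add: mult_ac)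
    finally have YW': "card (?Y ` \<Omega>) * card D ^ k \<le> W" .
    have "energy \<Omega> ?Y (A i) > 1 / \<delta> - real k * \<eta>\<^sup>2" if "i \<in> R2" for i
    proof -
      have "energy \<Omega> Y (A i) + \<eta>\<^sup>2 \<le> energy \<Omega> ?Y (A i)"
        using that by (simp add: R2_def gains_def)
      then show ?thesis using Suc.prems(4)[of i] that R2R by (auto simp: algebra_simps)
    qed
    then obtain R' where R': "R' \<subseteq> R2" "good_set \<epsilon> R'" "real (card R2) \<le> c ^ k * real (card R')"
      using Suc.IH[OF _ R2ne YW'] R2R Suc.prems(1) by blast
    have "c * real (card R2) \<le> c * (c ^ k * real (card R'))"
      using R'(3) c1 by (intro mult_left_mono) auto
    then have "real (card R) \<le> c ^ Suc k * real (card R')" using R2c by (simp add: mult.assoc)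
    then show ?thesis using R' R2R by blast
  qed
qed

text \<open>Start from the partition with a single label. Its energy is nonnegative, so the choice
  of \<open>k\<close> already gives the invariant, and \<open>card D ^ k\<close> bounds all later
  numbers of cells.\<close>

lemma exists_good_subset:
  fixes w k :: nat and \<epsilon> :: real
  assumes "\<epsilon> > 0" "w > 0" "real (card D ^ k) \<le> real w * \<eta>" "1 / \<delta> < real k * \<eta>\<^sup>2" "I \<noteq> {}"
  shows "\<exists>R\<subseteq>I. good_set \<epsilon> R \<and> real (card I)
      \<le> (real (w + 1) ^ (card D ^ k) * max 1 ((real m)\<^sup>2 * M / \<epsilon>)) ^ k * real (card R)"
proof (rule good_subset_from_energy[where Y = "\<lambda>_. []"])
  show "card ((\<lambda>_. []) ` \<Omega>) * card D ^ k \<le> card D ^ k"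
    using card_mono[of "{[]}" "(\<lambda>_. []) ` \<Omega>"] by auto
  show "1 / \<delta> - real k * \<eta>\<^sup>2 < energy \<Omega> (\<lambda>_. []) (A i)" for i
    by (rule less_le_trans[OF _ energy_nonneg]) (use assms(4) in simp)
qed (use assms in auto)

end

section \<open>Forms modulo a prime\<close>

lemma finsum_residue_ring:
  assumes "p > 1" "finite J" "f \<in> J \<rightarrow> carrier (F_ring p)"
  shows "(\<Oplus>\<^bsub>F_ring p\<^esub>i\<in>J. f i) = (\<Sum>i\<in>J. f i) mod int p"
proof -
  interpret residues "int p" "F_ring p"
    using assms(1) by unfold_locales auto
  show ?thesis
    using assms(2,3)
  proof (induction J)
    case empty
    then show ?case by (simp add: res_zero_eq)
  next
    case (insert j J)
    then have "(\<Oplus>\<^bsub>F_ring p\<^esub>i\<in>insert j J. f i) = f j \<oplus>\<^bsub>F_ring p\<^esub> (\<Oplus>\<^bsub>F_ring p\<^esub>i\<in>J. f i)"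
      by (intro finsum_insert) auto
    then show ?case using insert by (simp add: res_add_eq mod_add_right_eq)
  qed
qed

text \<open>\<open>mod_form\<close> fixes \<open>\<phi>\<close> only on \<open>F_space p n\<close>.
  Restricting the coefficient function to \<open>{1..n}\<close> places it in the finite set
  \<open>F_space p n\<close>, so finitely many representatives cover all forms.\<close>

lemma mod_form_eq_lform:
  assumes "prime p" "mod_form p n \<phi>"
  shows "\<exists>a\<in>F_space p n. \<forall>x\<in>F_space p n. \<phi> x = lform n a x mod int p"
proof -
  have p: "p > 1" using assms(1) prime_gt_1_nat by blast
  interpret residues "int p" "F_ring p"
    using p by unfold_locales auto
  obtain a where a: "a \<in> {1..n} \<rightarrow> carrier (F_ring p)"
    and \<phi>: "\<And>x. x \<in> F_space p n \<Longrightarrow> \<phi> x = (\<Oplus>\<^bsub>F_ring p\<^esub>i\<in>{1..n}. a i \<otimes>\<^bsub>F_ring p\<^esub> x i)"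
    using assms(2) unfolding mod_form_def by blast
  show ?thesis
  proof (intro bexI[of _ "restrict a {1..n}"] ballI)
    show "restrict a {1..n} \<in> F_space p n" using a by (auto simp: F_space_def)
    fix x assume x: "x \<in> F_space p n"
    have "(\<Oplus>\<^bsub>F_ring p\<^esub>i\<in>{1..n}. a i \<otimes>\<^bsub>F_ring p\<^esub> x i)
        = (\<Sum>i\<in>{1..n}. a i \<otimes>\<^bsub>F_ring p\<^esub> x i) mod int p"
      using a x p by (intro finsum_residue_ring) (auto simp: F_space_def PiE_iff intro!: m_closed)
    also have "\<dots> = (\<Sum>i\<in>{1..n}. a i * x i) mod int p"
      by (simp add: res_mult_eq mod_sum_eq)
    finally show "\<phi> x = lform n (restrict a {1..n}) x mod int p"
      using \<phi>[OF x] unfolding lform_def by (simp cong: sum.cong_simp)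
  qed
qed

lemma cor_on_eq_freq:
  assumes "\<And>j. j \<in> {1..m} \<Longrightarrow> finite (B j) \<and> B j \<noteq> {}"
  shows "cor_on D m B F = (\<Sum>d\<in>D. \<Prod>j\<in>{1..m}. freq (B j) F d) - 1 / real (card D) ^ (m - 1)"
  unfolding cor_on_def cor_def using assms
  by (intro arg_cong2[of _ _ _ _ minus] sum.cong prod.cong refl pmf_map_pmf_of_set) auto

section \<open>Choice of constants and conclusion for the cube\<close>

theorem mainTheorem1:
  fixes p m :: nat and \<delta> \<nu> \<epsilon> :: real
  assumes "prime p" and "m \<ge> 2" and "\<delta> > 0" and "\<nu> > 0" and "\<epsilon> > 0"
  shows "\<exists>C::real. C > 0 \<and>
    (\<forall>(n::nat) (s::nat) (A :: nat \<Rightarrow> (nat \<Rightarrow> int) set).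
      s > 0 \<longrightarrow>
      (\<forall>i\<in>{1..s}. A i \<noteq> {} \<and> A i \<subseteq> cube n \<and> cube_density n (A i) \<ge> \<delta>) \<longrightarrow>
      (\<exists>R \<subseteq> {1..s}.
        real (card R) \<ge> real s / (real n + 1) powr C \<and>
        real (card {t \<in> {1..m} \<rightarrow>\<^sub>E R.
            \<forall>\<phi>. mod_form p n \<phi> \<longrightarrow> cor_on (carrier (F_ring p)) m (\<lambda>j. A (t j)) \<phi> \<ge> - \<nu>})
          \<ge> (1 - \<epsilon>) * real (card R) ^ m))"
proof -
  have p1: "p > 1" using assms(1) prime_gt_1_nat by blast
  have carrier: "carrier (F_ring p) = {0..int p - 1}" by (simp add: residue_ring_def)
  define D where "D = {0..int p - 1}"
  have D: "finite D" "D \<noteq> {}" "card D = p" using p1 by (auto simp: D_def)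
  define \<eta> where "\<eta> = \<nu> / (3 * real p * real m)"
  have \<eta>: "\<eta> > 0" using assms p1 by (simp add: \<eta>_def)
  have \<eta>\<nu>: "3 * real p * real m * \<eta> = \<nu>" using assms p1 by (simp add: \<eta>_def)
  obtain K' L where K': "K' \<ge> 0" and few: "\<forall>n A. A \<subseteq> cube n \<longrightarrow> \<delta> * 2 ^ n \<le> real (card A) \<longrightarrow>
    real (card {a \<in> F_space p n. \<exists>d\<in>{0..int p - 1}.
      \<bar>freq A (\<lambda>x. lform n a x mod int p) d - 1 / real p\<bar> > \<eta>}) \<le> K' * (real n + 1) ^ L"
    using biased_forms_polynomially_many[OF assms(1,3) \<eta>] by blast
  \<comment> \<open>Adding 1 makes \<open>K\<close>, and with it the bound \<open>M\<close>,
    strictly positive.\<close>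
  define K where "K = K' + 1"
  obtain k :: nat where "1 / \<delta> / \<eta>\<^sup>2 < real k" using reals_Archimedean2 by blast
  then have k: "1 / \<delta> < real k * \<eta>\<^sup>2" using \<eta> assms(3) by (simp add: field_simps)
  obtain w' :: nat where "real (p ^ k) / \<eta> < real w'" using reals_Archimedean2 by blast
  then have w': "real (p ^ k) \<le> real (w' + 1) * \<eta>" using \<eta> by (simp add: field_simps)
  define w where "w = w' + 1"
  define c where "c = real (w + 1) ^ (p ^ k) * max 1 ((real m)\<^sup>2 * K / \<epsilon>)"
  \<comment> \<open>For \<open>n \<ge> 1\<close> the constant \<open>c ^ k\<close> is then below
    \<open>(n + 1) ^ N\<close>, so it can be absorbed into the exponent \<open>C\<close>.\<close>
  obtain N where N: "c ^ k < 2 ^ N" using real_arch_pow[of 2 "c ^ k"] by auto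
  define C where "C = N + L * k + 1"
  show ?thesis
  proof (intro exI[of _ "real C"] conjI allI impI)
    show "real C > 0" unfolding of_nat_0_less_iff C_def by simp
    fix n s :: nat and A :: "nat \<Rightarrow> (nat \<Rightarrow> int) set"
    assume s: "s > 0" and A: "\<forall>i\<in>{1..s}. A i \<noteq> {} \<and> A i \<subseteq> cube n \<and> cube_density n (A i) \<ge> \<delta>"
    define \<Phi> where "\<Phi> = (\<lambda>a x. lform n a x mod int p) ` F_space p n"
    define M where "M = K * (real n + 1) ^ L"
    have n1: "(real n + 1) ^ L \<ge> 1" by (simp add: one_le_power)
    have M: "M > 0" using K' n1 by (simp add: M_def K_def)
    interpret dense_sets_with_forms "cube n" \<Phi> D "{1..s}" A m \<delta> \<eta> M
    proof
      fix i assume i: "i \<in> {1..s}"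
      show "\<delta> * real (card (cube n)) \<le> real (card (A i))"
        using A i by (simp add: cube_density_def card_cube field_simps)
      then have "real (card {a \<in> F_space p n. \<exists>d\<in>{0..int p - 1}.
          \<bar>freq (A i) (\<lambda>x. lform n a x mod int p) d - 1 / real p\<bar> > \<eta>}) \<le> K' * (real n + 1) ^ L"
        using A i by (intro few[rule_format]) (auto simp: card_cube)
      also have "\<dots> \<le> M" using n1 by (simp add: M_def K_def distrib_right)
      finally have bnd: "real (card {a \<in> F_space p n. \<exists>d\<in>D.
          \<bar>freq (A i) (\<lambda>x. lform n a x mod int p) d - 1 / real p\<bar> > \<eta>}) \<le> M"
        by (simp add: D_def)
      have "{\<phi> \<in> \<Phi>. \<exists>d\<in>D. \<eta> < \<bar>freq (A i) \<phi> d - 1 / real (card D)\<bar>}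
          = (\<lambda>a x. lform n a x mod int p) ` {a \<in> F_space p n. \<exists>d\<in>D.
          \<bar>freq (A i) (\<lambda>x. lform n a x mod int p) d - 1 / real p\<bar> > \<eta>}"
        unfolding \<Phi>_def D(3) by blast
      then have "card {\<phi> \<in> \<Phi>. \<exists>d\<in>D. \<eta> < \<bar>freq (A i) \<phi> d - 1 / real (card D)\<bar>}
          \<le> card {a \<in> F_space p n. \<exists>d\<in>D.
          \<bar>freq (A i) (\<lambda>x. lform n a x mod int p) d - 1 / real p\<bar> > \<eta>}"
        by (simp add: card_image_le)
      then show "real (card {\<phi> \<in> \<Phi>. \<exists>d\<in>D. \<eta> < \<bar>freq (A i) \<phi> d - 1 / real (card D)\<bar>}) \<le> M"
        using bnd by linarith
    next
      fix \<phi> assume "\<phi> \<in> \<Phi>"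
      then show "\<phi> ` cube n \<subseteq> D" using p1 by (auto simp: \<Phi>_def D_def)
    qed (use A D assms \<eta> M in \<open>auto simp: \<Phi>_def\<close>)
    have good_imp: "cor_on (carrier (F_ring p)) m (\<lambda>j. A (t j)) \<phi> \<ge> - \<nu>"
      if t: "t \<in> {1..m} \<rightarrow>\<^sub>E R" "R \<subseteq> {1..s}" "good_tuple t" and \<phi>: "mod_form p n \<phi>" for t R \<phi>
    proof -
      have ti: "t j \<in> {1..s}" if "j \<in> {1..m}" for j using PiE_mem[OF t(1) that] t(2) by blast
      obtain a where a: "a \<in> F_space p n" "\<And>x. x \<in> F_space p n \<Longrightarrow> \<phi> x = lform n a x mod int p"
        using mod_form_eq_lform[OF assms(1) \<phi>] by blast
      \<comment> \<open>Agreement on \<open>F_space p n\<close> suffices, because it contains the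
        cube and hence every \<open>A (t j)\<close>.\<close>
      have fr: "freq (A (t j)) \<phi> d = freq (A (t j)) (\<lambda>x. lform n a x mod int p) d"
        if "j \<in> {1..m}" for j d
        using A ti[OF that] cube_subset_F_space[OF assms(1), of n] by (intro freq_cong a(2)) blast
      have "cor_on (carrier (F_ring p)) m (\<lambda>j. A (t j)) \<phi>
          = (\<Sum>d\<in>D. \<Prod>j\<in>{1..m}. freq (A (t j)) \<phi> d) - 1 / real (card D) ^ (m - 1)"
        unfolding carrier D_def using ti finite_A A by (intro cor_on_eq_freq) auto
      moreover have "(\<Sum>d\<in>D. \<Prod>j\<in>{1..m}. freq (A (t j)) \<phi> d)
          = (\<Sum>d\<in>D. \<Prod>j\<in>{1..m}. freq (A (t j)) (\<lambda>x. lform n a x mod int p) d)"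
        using fr by (intro sum.cong prod.cong) auto
      moreover have "(\<lambda>x. lform n a x mod int p) \<in> \<Phi>" using a(1) by (simp add: \<Phi>_def)
      then have "1 / real (card D) ^ (m - 1) - 3 * real (card D) * real m * \<eta>
          \<le> (\<Sum>d\<in>D. \<Prod>j\<in>{1..m}. freq (A (t j)) (\<lambda>x. lform n a x mod int p) d)"
        using t(3) unfolding good_tuple_def by blast
      ultimately show ?thesis using \<eta>\<nu> unfolding D(3) by linarith
    qed
    have conclude: "real (card {t \<in> {1..m} \<rightarrow>\<^sub>E R.
            \<forall>\<phi>. mod_form p n \<phi> \<longrightarrow> cor_on (carrier (F_ring p)) m (\<lambda>j. A (t j)) \<phi> \<ge> - \<nu>})
          \<ge> (1 - \<epsilon>) * real (card R) ^ m" if R: "R \<subseteq> {1..s}" "good_set \<epsilon> R" for R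
    proof -
      have "finite R" using R finite_subset by blast
      then have "card {t \<in> {1..m} \<rightarrow>\<^sub>E R. good_tuple t} \<le> card {t \<in> {1..m} \<rightarrow>\<^sub>E R.
            \<forall>\<phi>. mod_form p n \<phi> \<longrightarrow> cor_on (carrier (F_ring p)) m (\<lambda>j. A (t j)) \<phi> \<ge> - \<nu>}"
        using good_imp R(1) by (intro card_mono) (auto intro!: finite_PiE)
      then show ?thesis using R(2) unfolding good_set_def by linarith
    qed
    show "\<exists>R \<subseteq> {1..s}.
        real (card R) \<ge> real s / (real n + 1) powr (real C) \<and>
        real (card {t \<in> {1..m} \<rightarrow>\<^sub>E R.
            \<forall>\<phi>. mod_form p n \<phi> \<longrightarrow> cor_on (carrier (F_ring p)) m (\<lambda>j. A (t j)) \<phi> \<ge> - \<nu>})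
          \<ge> (1 - \<epsilon>) * real (card R) ^ m"
    proof (cases "n = 0")
      \<comment> \<open>Here \<open>n + 1 = 1\<close> and no power of it absorbs a constant. But the
        cube is a single point, all the sets coincide, and the full index set is good.\<close>
      case True
      have single: "A i = cube 0" if "i \<in> {1..s}" for i
        using A that True by (auto simp: cube_def)
      have "good_tuple t" if t: "t \<in> {1..m} \<rightarrow>\<^sub>E {1..s}" for t
        unfolding good_tuple_def
      proof
        fix \<phi> assume \<phi>: "\<phi> \<in> \<Phi>"
        have ti: "t j \<in> {1..s}" if "j \<in> {1..m}" for j using PiE_mem[OF t that] .
        have t1: "t 1 \<in> {1..s}" using assms(2) by (intro ti) auto
        have sum1: "(\<Sum>d\<in>D. freq (A (t 1)) \<phi> d) = 1" using sum_freq_form[OF t1 \<phi>] .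
        have q01: "0 \<le> freq (A (t j)) \<phi> d \<and> freq (A (t j)) \<phi> d \<le> 1" if "j \<in> {1..m}" for j d
          using freq_nonneg[of "A (t j)" \<phi> d] freq_le_1[OF finite_A[OF ti[OF that]], of \<phi> d] ..
        have same: "\<bar>freq (A (t j)) \<phi> d - freq (A (t 1)) \<phi> d\<bar> \<le> 3 * \<eta>" if "j \<in> {1..m}" for j d
          using single[OF ti[OF that]] single[OF t1] \<eta> by simp
        have "1 / real (card D) ^ (m - 1) - real (card D) * real m * (3 * \<eta>)
            \<le> (\<Sum>d\<in>D. \<Prod>j\<in>{1..m}. freq (A (t j)) \<phi> d)"
          using assms(2) by (intro sum_prod_ge_if_all_close D q01 sum1 same) auto
        then show "1 / real (card D) ^ (m - 1) - 3 * real (card D) * real m * \<eta>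
            \<le> (\<Sum>d\<in>D. \<Prod>j\<in>{1..m}. freq (A (t j)) \<phi> d)"
          by (simp add: mult_ac)
      qed
      then have "{t \<in> {1..m} \<rightarrow>\<^sub>E {1..s}. good_tuple t} = {1..m} \<rightarrow>\<^sub>E {1..s}" by auto
      then have "good_set \<epsilon> {1..s}"
        using assms(5) by (simp add: good_set_def card_PiE algebra_simps)
      then show ?thesis
        using conclude[of "{1..s}"] True by (intro exI[of _ "{1..s}"]) auto
    next
      case False
      obtain R where R: "R \<subseteq> {1..s}" "good_set \<epsilon> R"
        and sz: "real (card {1..s})
          \<le> (real (w + 1) ^ (card D ^ k) * max 1 ((real m)\<^sup>2 * M / \<epsilon>)) ^ k * real (card R)"
        using exists_good_subset[of \<epsilon> w k] assms(5) w' k s D(3) by (auto simp: w_def)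
      \<comment> \<open>Only \<open>M\<close> depends on \<open>n\<close>; its polynomial factor is
        pulled out, so each of the \<open>k\<close> rounds costs a constant times
        \<open>(n + 1) ^ L\<close>.\<close>
      have "max 1 ((real m)\<^sup>2 * M / \<epsilon>) \<le> max 1 ((real m)\<^sup>2 * K / \<epsilon>) * (real n + 1) ^ L"
      proof (rule max.boundedI)
        show "1 \<le> max 1 ((real m)\<^sup>2 * K / \<epsilon>) * (real n + 1) ^ L"
          using mult_mono[of 1 "max 1 ((real m)\<^sup>2 * K / \<epsilon>)" 1 "(real n + 1) ^ L"] n1 by simp
        have "(real m)\<^sup>2 * M / \<epsilon> = (real m)\<^sup>2 * K / \<epsilon> * (real n + 1) ^ L" by (simp add: M_def)
        also have "\<dots> \<le> max 1 ((real m)\<^sup>2 * K / \<epsilon>) * (real n + 1) ^ L"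
          using n1 by (intro mult_right_mono) auto
        finally show "(real m)\<^sup>2 * M / \<epsilon> \<le> max 1 ((real m)\<^sup>2 * K / \<epsilon>) * (real n + 1) ^ L" .
      qed
      then have "real (w + 1) ^ (p ^ k) * max 1 ((real m)\<^sup>2 * M / \<epsilon>) \<le> c * (real n + 1) ^ L"
        unfolding c_def mult.assoc by (intro mult_left_mono) auto
      then have "(real (w + 1) ^ (p ^ k) * max 1 ((real m)\<^sup>2 * M / \<epsilon>)) ^ k
          \<le> (c * (real n + 1) ^ L) ^ k"
        by (intro power_mono) auto
      also have "\<dots> = c ^ k * (real n + 1) ^ (L * k)" by (simp add: power_mult_distrib power_mult)
      also have "\<dots> \<le> (real n + 1) ^ N * (real n + 1) ^ (L * k)"
      proof (intro mult_right_mono)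
        have "(2::real) ^ N \<le> (real n + 1) ^ N" using False by (intro power_mono) auto
        then show "c ^ k \<le> (real n + 1) ^ N" using N by linarith
      qed auto
      also have "\<dots> = (real n + 1) ^ (N + L * k)" by (simp add: power_add)
      also have "\<dots> \<le> (real n + 1) ^ C" by (intro power_increasing) (auto simp: C_def)
      finally have "(real (w + 1) ^ (p ^ k) * max 1 ((real m)\<^sup>2 * M / \<epsilon>)) ^ k * real (card R)
          \<le> (real n + 1) ^ C * real (card R)"
        by (rule mult_right_mono) simp
      then have "real s \<le> (real n + 1) ^ C * real (card R)" using sz D(3) by simp
      then have "real s / (real n + 1) powr (real C) \<le> real (card R)"
        by (simp add: powr_realpow field_simps)
      then show ?thesis using R conclude[OF R] by blast
    qed
  qed
qed

end
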